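(* Let $k$ be a field of characteristic zero and $A=k[x_1][x_2;\alpha_2,\delta_2]_p\cdots[x_n;\alpha_n,\delta_n]_p$ an iterated Poisson polynomial algebra such that (a) $\delta_i$ is locally nilpotent for all $i$; (b) there exist $s_i\in k^\times$ with $\alpha_i\delta_i=\delta_i(\alpha_i+s_i)$ for all $i$; (c) there exist $\lambda_{ij}\in k$ with $\alpha_i(x_j)=\lambda_{ij}x_j$ for all $i>j$. Let ${\boldsymbol\lambda}=(\lambda_{ij})$ be the antisymmetric matrix in $M_n(k)$ whose entries below the diagonal are the scalars in (c). Then: (1) $\operatorname{Fract}A\cong k_{\boldsymbol\lambda}(y_1,\dots,y_n)$ as Poisson algebras. (2) For any Poisson prime ideal $P$ of $A$, there exist a field extension $K\supseteq k$ and an antisymmetric ${\boldsymbol\mu}\in M_m(k)$, for some $m\le n$, such that $\operatorname{Fract}A/P\cong K_{\boldsymbol\mu}(y_1,\dots,y_m)$ as Poisson algebras; in fact ${\boldsymbol\mu}$ is the upper left $m\times m$ submatrix of ${\boldsymbol\sigma}{\boldsymbol\lambda}{\boldsymbol\sigma}^{\mathrm{tr}}$ for some ${\boldsymbol\sigma}\in GL_n(\mathbb Z)$.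
   Context: If $B$ is a Poisson algebra, $\alpha$ a Poisson derivation of $B$ and $\delta$ a derivation of $B$ with $\delta(\{a,b\})=\{\delta(a),b\}+\{a,\delta(b)\}+\alpha(a)\delta(b)-\delta(a)\alpha(b)$, then $B[x;\alpha,\delta]_p$ is $B[x]$ with the unique Poisson bracket extending that of $B$ with $\{x,b\}=\alpha(b)x+\delta(b)$; an iterated Poisson polynomial algebra iterates this starting from $k[x_1]$ with zero bracket. For a field $K\supseteq k$ and antisymmetric ${\boldsymbol\mu}\in M_m(k)$, $K_{\boldsymbol\mu}(y_1,\dots,y_m)$ is the rational function field over $K$ with the unique $K$-linear Poisson bracket satisfying $\{y_i,y_j\}=\mu_{ij}y_iy_j$. A Poisson prime ideal is a prime ideal $P$ with $\{A,P\}\subseteq P$; the bracket extends uniquely to quotient fields. *)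

theory Defs
  imports Main "HOL-Library.Multiset"
begin

definition mono :: "(nat \<Rightarrow> 'a::comm_ring_1) \<Rightarrow> nat multiset \<Rightarrow> 'a" where
  "mono y M = prod_mset (image_mset y M)"

definition poly_span :: "'a::comm_ring_1 set \<Rightarrow> (nat \<Rightarrow> 'a) \<Rightarrow> nat \<Rightarrow> 'a set" where
  "poly_span K y m = {(\<Sum>M\<in>S. c M * mono y M) | S c.
      finite S \<and> (\<forall>M\<in>S. set_mset M \<subseteq> {..<m} \<and> c M \<in> K)}"

definition alg_indep :: "'a::comm_ring_1 set \<Rightarrow> (nat \<Rightarrow> 'a) \<Rightarrow> nat \<Rightarrow> bool" where
  "alg_indep K y m \<longleftrightarrow> (\<forall>S c. finite S \<and> (\<forall>M\<in>S. set_mset M \<subseteq> {..<m} \<and> c M \<in> K)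
      \<and> (\<Sum>M\<in>S. c M * mono y M) = 0 \<longrightarrow> (\<forall>M\<in>S. c M = 0))"

definition subfield_set :: "'a::comm_ring_1 set \<Rightarrow> bool" where
  "subfield_set K \<longleftrightarrow> 0 \<in> K \<and> 1 \<in> K \<and> (\<forall>a\<in>K. \<forall>b\<in>K. a + b \<in> K \<and> a * b \<in> K)
     \<and> (\<forall>a\<in>K. - a \<in> K \<and> (a \<noteq> 0 \<longrightarrow> (\<exists>b\<in>K. a * b = 1)))"

definition poisson_bracket :: "('a::comm_ring_1 \<Rightarrow> 'a \<Rightarrow> 'a) \<Rightarrow> bool" where
  "poisson_bracket br \<longleftrightarrow>
     (\<forall>a b c. br (a + b) c = br a c + br b c) \<and>
     (\<forall>a b. br a b = - br b a) \<and>
     (\<forall>a b c. br a (br b c) + br b (br c a) + br c (br a b) = 0) \<and>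
     (\<forall>a b c. br a (b * c) = br a b * c + b * br a c)"

definition k_linear_bracket :: "'a::comm_ring_1 set \<Rightarrow> ('a \<Rightarrow> 'a \<Rightarrow> 'a) \<Rightarrow> bool" where
  "k_linear_bracket k br \<longleftrightarrow> (\<forall>c\<in>k. \<forall>a b. br (c * a) b = c * br a b)"

definition derivation_on :: "'a::comm_ring_1 set \<Rightarrow> 'a set \<Rightarrow> ('a \<Rightarrow> 'a) \<Rightarrow> bool" where
  "derivation_on k B d \<longleftrightarrow> (\<forall>b\<in>B. d b \<in> B) \<and>
     (\<forall>a\<in>B. \<forall>b\<in>B. d (a + b) = d a + d b \<and> d (a * b) = d a * b + a * d b) \<and>
     (\<forall>c\<in>k. \<forall>b\<in>B. d (c * b) = c * d b)"

definition poisson_derivation_on ::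
  "'a::comm_ring_1 set \<Rightarrow> ('a \<Rightarrow> 'a \<Rightarrow> 'a) \<Rightarrow> 'a set \<Rightarrow> ('a \<Rightarrow> 'a) \<Rightarrow> bool" where
  "poisson_derivation_on k br B d \<longleftrightarrow> derivation_on k B d \<and>
     (\<forall>a\<in>B. \<forall>b\<in>B. d (br a b) = br (d a) b + br a (d b))"

definition skew_poisson_condition ::
  "('a::comm_ring_1 \<Rightarrow> 'a \<Rightarrow> 'a) \<Rightarrow> 'a set \<Rightarrow> ('a \<Rightarrow> 'a) \<Rightarrow> ('a \<Rightarrow> 'a) \<Rightarrow> bool" where
  "skew_poisson_condition br B \<alpha> \<delta> \<longleftrightarrow> (\<forall>a\<in>B. \<forall>b\<in>B.
     \<delta> (br a b) = br (\<delta> a) b + br a (\<delta> b) + \<alpha> a * \<delta> b - \<delta> a * \<alpha> b)"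

text \<open>The ring 'a (with bracket br) is the iterated Poisson polynomial algebra
  k[x_0][x_1;alpha_1,delta_1]_p ... [x_(n-1);alpha_(n-1),delta_(n-1)]_p (0-based indices).
  A_i = poly_span k x i is the subalgebra k[x_0,...,x_(i-1)].\<close>
definition iterated_PPA ::
  "'a::comm_ring_1 set \<Rightarrow> ('a \<Rightarrow> 'a \<Rightarrow> 'a) \<Rightarrow> (nat \<Rightarrow> 'a) \<Rightarrow> nat
     \<Rightarrow> (nat \<Rightarrow> 'a \<Rightarrow> 'a) \<Rightarrow> (nat \<Rightarrow> 'a \<Rightarrow> 'a) \<Rightarrow> bool" where
  "iterated_PPA k br x n \<alpha> \<delta> \<longleftrightarrow>
     1 \<le> n \<and> subfield_set k \<and> alg_indep k x n \<and> poly_span k x n = UNIV \<and>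
     poisson_bracket br \<and> k_linear_bracket k br \<and>
     (\<forall>i. 1 \<le> i \<and> i < n \<longrightarrow>
        poisson_derivation_on k br (poly_span k x i) (\<alpha> i) \<and>
        derivation_on k (poly_span k x i) (\<delta> i) \<and>
        skew_poisson_condition br (poly_span k x i) (\<alpha> i) (\<delta> i) \<and>
        (\<forall>b\<in>poly_span k x i. br (x i) b = \<alpha> i b * x i + \<delta> i b))"

definition poisson_prime_ideal :: "('a::comm_ring_1 \<Rightarrow> 'a \<Rightarrow> 'a) \<Rightarrow> 'a set \<Rightarrow> bool" where
  "poisson_prime_ideal br P \<longleftrightarrow>
     0 \<in> P \<and> (\<forall>p\<in>P. \<forall>q\<in>P. p + q \<in> P) \<and> (\<forall>a. \<forall>p\<in>P. a * p \<in> P) \<and>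
     P \<noteq> UNIV \<and> (\<forall>a b. a * b \<in> P \<longrightarrow> a \<in> P \<or> b \<in> P) \<and>
     (\<forall>a. \<forall>p\<in>P. br a p \<in> P)"

text \<open>(F, brF) together with h is (a copy of) Fract(A/P) with the Poisson bracket induced
  from A: h is a ring homomorphism A -> F with kernel P, F is generated as a field by
  h(A) (i.e. it is the field of fractions of h(A) = A/P), and h is a Poisson map.\<close>
definition fract_quotient ::
  "('a::comm_ring_1 \<Rightarrow> 'a \<Rightarrow> 'a) \<Rightarrow> 'a set \<Rightarrow> ('b::field \<Rightarrow> 'b \<Rightarrow> 'b) \<Rightarrow> ('a \<Rightarrow> 'b) \<Rightarrow> bool" where
  "fract_quotient br P brF h \<longleftrightarrow>
     (\<forall>a b. h (a + b) = h a + h b) \<and> (\<forall>a b. h (a * b) = h a * h b) \<and> h 1 = 1 \<and>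
     {a. h a = 0} = P \<and> (\<forall>z. \<exists>a b. h b \<noteq> 0 \<and> z = h a / h b) \<and>
     poisson_bracket brF \<and> (\<forall>a b. h (br a b) = brF (h a) (h b))"

text \<open>The Poisson field (F, brF) is isomorphic, as Poisson k-algebras (k given by its image
  k' in F), to K_mu(y_0,...,y_(m-1)): F contains a subfield K containing k', elements
  y_0,...,y_(m-1) algebraically independent over K with F = K(y_0,...,y_(m-1)), the bracket
  is K-linear, and brF (y i) (y j) = mu i j * y i * y j.\<close>
definition poisson_rational_form ::
  "('b::field \<Rightarrow> 'b \<Rightarrow> 'b) \<Rightarrow> 'b set \<Rightarrow> 'b set \<Rightarrow> (nat \<Rightarrow> 'b) \<Rightarrow> nat \<Rightarrow> (nat \<Rightarrow> nat \<Rightarrow> 'b) \<Rightarrow> bool" where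
  "poisson_rational_form brF k' K y m \<mu> \<longleftrightarrow>
     subfield_set K \<and> k' \<subseteq> K \<and> alg_indep K y m \<and>
     (\<forall>z. \<exists>p\<in>poly_span K y m. \<exists>q\<in>poly_span K y m. q \<noteq> 0 \<and> z = p / q) \<and>
     (\<forall>c\<in>K. \<forall>z. brF c z = 0) \<and>
     (\<forall>i<m. \<forall>j<m. brF (y i) (y j) = \<mu> i j * y i * y j)"

definition antisym_completion :: "(nat \<Rightarrow> nat \<Rightarrow> 'a::comm_ring_1) \<Rightarrow> nat \<Rightarrow> nat \<Rightarrow> 'a" where
  "antisym_completion lam i j = (if j < i then lam i j else if i < j then - lam j i else 0)"

definition GL_int :: "nat \<Rightarrow> (nat \<Rightarrow> nat \<Rightarrow> int) \<Rightarrow> bool" where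
  "GL_int n \<sigma> \<longleftrightarrow> (\<exists>\<tau>. \<forall>i<n. \<forall>j<n.
      (\<Sum>l<n. \<sigma> i l * \<tau> l j) = (if i = j then 1 else 0) \<and>
      (\<Sum>l<n. \<tau> i l * \<sigma> l j) = (if i = j then 1 else 0))"

definition conj_entry :: "nat \<Rightarrow> (nat \<Rightarrow> nat \<Rightarrow> int) \<Rightarrow> (nat \<Rightarrow> nat \<Rightarrow> 'a::comm_ring_1) \<Rightarrow> nat \<Rightarrow> nat \<Rightarrow> 'a" where
  "conj_entry n \<sigma> L i j = (\<Sum>a<n. \<Sum>b<n. of_int (\<sigma> i a * \<sigma> j b) * L a b)"

end

theory Submission
  imports Defs "HOL-Computational_Algebra.Polynomial"
begin

text \<open>
  The proof deletes the derivations \<open>\<delta>\<^sub>n, \<dots>, \<delta>\<^sub>2\<close> one at a time, working with elements of the field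
  \<open>F = Fract A/P\<close>. Let \<open>\<theta>\<close> be a Poisson homomorphism from \<open>B[z; \<alpha>, \<delta>]\<^sub>p\<close> to \<open>F\<close>, and write \<open>z\<close> for \<open>\<theta>(z)\<close>.
  If \<open>z \<noteq> 0\<close>, then with \<open>t = - 1 / (s z)\<close> the map \<open>\<theta>'(b) = \<Sum> \<theta>(\<delta>\<^sup>l b) t\<^sup>l / l!\<close> is again a Poisson homomorphism on
  \<open>B\<close>, now with \<open>{z, \<theta>'(b)} = \<theta>'(\<alpha> b) z\<close>, and \<open>\<theta>'(B)\<close> and \<open>z\<close> generate the same field as \<open>\<theta>(B)\<close> and \<open>z\<close>.
  If \<open>z = 0\<close>, then \<open>\<theta>\<close> kills \<open>\<delta>(B)\<close> and \<open>\<theta>' = \<theta>\<close> already has this property. Iterating yields generators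
  \<open>y\<^sub>1, \<dots>, y\<^sub>n\<close> of \<open>F\<close> with \<open>{y\<^sub>i, y\<^sub>j} = \<lambda>\<^sub>i\<^sub>j y\<^sub>i y\<^sub>j\<close>. For \<open>P = 0\<close> they stay algebraically independent, because
  \<open>\<theta>'(b)\<close> equals \<open>\<theta>(b)\<close> up to lower powers of \<open>z\<close>.

  In general, let \<open>K\<close> be the Poisson centre of \<open>F\<close>. Unimodular row operations on the exponents and dropping
  of central generators lead to a minimal generating set \<open>u\<^sub>1, \<dots>, u\<^sub>m\<close> over \<open>K\<close>. By minimality distinct
  monomials in the \<open>u\<^sub>i\<close> have distinct weights under the derivations \<open>u\<^sub>j\<^sup>-\<^sup>1 {u\<^sub>j, -}\<close>, so they are linearly
  independent over \<open>K\<close>.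
\<close>

section \<open>Spans of monomials\<close>

lemma subfield_setD:
  assumes "subfield_set K"
  shows "0 \<in> K" "1 \<in> K" "\<And>a b. a \<in> K \<Longrightarrow> b \<in> K \<Longrightarrow> a + b \<in> K"
    "\<And>a b. a \<in> K \<Longrightarrow> b \<in> K \<Longrightarrow> a * b \<in> K" "\<And>a. a \<in> K \<Longrightarrow> - a \<in> K"
    "\<And>a b. a \<in> K \<Longrightarrow> b \<in> K \<Longrightarrow> a - b \<in> K"
  using assms unfolding subfield_set_def by (auto simp only: diff_conv_add_uminus)

lemma subfield_set_power: "subfield_set K \<Longrightarrow> a \<in> K \<Longrightarrow> a ^ n \<in> K"
  by (induction n) (auto intro: subfield_setD)

lemma subfield_set_of_nat: "subfield_set K \<Longrightarrow> of_nat n \<in> K"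
  by (induction n) (auto intro: subfield_setD)

lemma subfield_set_sum: "subfield_set K \<Longrightarrow> (\<And>i. i \<in> S \<Longrightarrow> f i \<in> K) \<Longrightarrow> sum f S \<in> K"
  by (induction S rule: infinite_finite_induct) (auto intro: subfield_setD)

lemma subfield_set_divide:
  fixes K :: "'b::field set"
  assumes "subfield_set K" "a \<in> K" "b \<in> K"
  shows "a / b \<in> K"
proof (cases "b = 0")
  case True
  then show ?thesis using assms by (simp add: subfield_set_def)
next
  case False
  then obtain c where "c \<in> K" "b * c = 1" using assms by (auto simp: subfield_set_def)
  then have "a / b = a * c" using False by (simp add: field_simps)
  then show ?thesis using assms \<open>c \<in> K\<close> by (auto simp: subfield_set_def)
qed

lemma mono_empty [simp]: "mono y {#} = 1"
  and mono_add_mset [simp]: "mono y (add_mset i M) = y i * mono y M"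
  and mono_union [simp]: "mono y (M + N) = mono y M * mono y N"
  and mono_replicate [simp]: "mono y (replicate_mset e i) = y i ^ e"
  by (auto simp: mono_def)

lemma mono_cong: "(\<And>i. i \<in># M \<Longrightarrow> y i = y' i) \<Longrightarrow> mono y M = mono y' M"
  by (simp add: mono_def cong: image_mset_cong)

lemma poly_span_monoI:
  assumes "c \<in> K" "set_mset M \<subseteq> {..<m}"
  shows "c * mono y M \<in> poly_span K y m"
  unfolding poly_span_def using assms by (auto intro!: exI[of _ "{M}"] exI[of _ "\<lambda>_. c"])

lemma poly_span_const: "c \<in> K \<Longrightarrow> c \<in> poly_span K y m"
  using poly_span_monoI[of c K "{#}" m y] by simp

lemma poly_span_var: "subfield_set K \<Longrightarrow> i < m \<Longrightarrow> y i \<in> poly_span K y m"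
  using poly_span_monoI[of 1 K "{#i#}" m y] by (simp add: subfield_setD)

lemma poly_span_add:
  assumes K: "subfield_set K" and "a \<in> poly_span K y m" "b \<in> poly_span K y m"
  shows "a + b \<in> poly_span K y m"
proof -
  obtain S c where S: "finite S" "\<forall>M\<in>S. set_mset M \<subseteq> {..<m} \<and> c M \<in> K" "a = (\<Sum>M\<in>S. c M * mono y M)"
    using assms(2) unfolding poly_span_def by blast
  obtain T d where T: "finite T" "\<forall>M\<in>T. set_mset M \<subseteq> {..<m} \<and> d M \<in> K" "b = (\<Sum>M\<in>T. d M * mono y M)"
    using assms(3) unfolding poly_span_def by blast
  define c' where "c' M = (if M \<in> S then c M else 0)" for M
  define d' where "d' M = (if M \<in> T then d M else 0)" for M
  have a: "a = (\<Sum>M\<in>S \<union> T. c' M * mono y M)"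
    unfolding S(3) using S(1) T(1) by (intro sum.mono_neutral_cong_left) (auto simp: c'_def)
  have b: "b = (\<Sum>M\<in>S \<union> T. d' M * mono y M)"
    unfolding T(3) using S(1) T(1) by (intro sum.mono_neutral_cong_left) (auto simp: d'_def)
  have "a + b = (\<Sum>M\<in>S \<union> T. (c' M + d' M) * mono y M)"
    unfolding a b by (simp add: sum.distrib algebra_simps)
  moreover have "\<forall>M\<in>S \<union> T. set_mset M \<subseteq> {..<m} \<and> c' M + d' M \<in> K"
    using S(2) T(2) by (auto simp: c'_def d'_def intro!: subfield_setD[OF K])
  ultimately show ?thesis
    unfolding poly_span_def using S(1) T(1) by (auto intro!: exI[of _ "S \<union> T"] exI[of _ "\<lambda>M. c' M + d' M"])
qed

lemma poly_span_sum:
  assumes "subfield_set K" "\<And>i. i \<in> S \<Longrightarrow> f i \<in> poly_span K y m"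
  shows "sum f S \<in> poly_span K y m"
  using assms(2)
  by (induction S rule: infinite_finite_induct)
    (auto intro: poly_span_add[OF assms(1)] poly_span_const subfield_setD[OF assms(1)])

lemma poly_span_mult:
  assumes K: "subfield_set K" and "a \<in> poly_span K y m" "b \<in> poly_span K y m"
  shows "a * b \<in> poly_span K y m"
proof -
  obtain S c where S: "finite S" "\<forall>M\<in>S. set_mset M \<subseteq> {..<m} \<and> c M \<in> K" "a = (\<Sum>M\<in>S. c M * mono y M)"
    using assms(2) unfolding poly_span_def by blast
  obtain T d where T: "finite T" "\<forall>M\<in>T. set_mset M \<subseteq> {..<m} \<and> d M \<in> K" "b = (\<Sum>M\<in>T. d M * mono y M)"
    using assms(3) unfolding poly_span_def by blast
  have "a * b = (\<Sum>M\<in>S. \<Sum>N\<in>T. (c M * d N) * mono y (M + N))"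
    unfolding S(3) T(3) sum_product by (simp add: algebra_simps)
  also have "\<dots> \<in> poly_span K y m"
    using S(2) T(2) by (intro poly_span_sum[OF K] poly_span_monoI) (auto intro: subfield_setD[OF K])
  finally show ?thesis .
qed

lemma poly_span_minus: "subfield_set K \<Longrightarrow> a \<in> poly_span K y m \<Longrightarrow> - a \<in> poly_span K y m"
  using poly_span_mult[of K "-1" y m a] poly_span_const[of "-1" K y m] by (simp add: subfield_setD)

lemma poly_span_diff:
  "subfield_set K \<Longrightarrow> a \<in> poly_span K y m \<Longrightarrow> b \<in> poly_span K y m \<Longrightarrow> a - b \<in> poly_span K y m"
  using poly_span_add[of K a y m "- b"] poly_span_minus by fastforce

lemma poly_span_power: "subfield_set K \<Longrightarrow> a \<in> poly_span K y m \<Longrightarrow> a ^ n \<in> poly_span K y m"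
  by (induction n) (auto intro: poly_span_mult poly_span_const subfield_setD)

lemma poly_span_mono: "m \<le> m' \<Longrightarrow> poly_span K y m \<subseteq> poly_span K y m'"
  unfolding poly_span_def by (smt (verit) Collect_mono lessThan_subset_iff subset_trans)

lemma poly_span_0: "subfield_set K \<Longrightarrow> poly_span K y 0 = K"
proof
  assume K: "subfield_set K"
  show "poly_span K y 0 \<subseteq> K"
    unfolding poly_span_def by (auto intro!: subfield_set_sum[OF K])
qed (auto intro: poly_span_const)

text \<open>The span is the subring generated by \<open>K\<close> and the \<open>y i\<close>, so a
  property can be checked on these and carried through sums and products. The membership premises in
  \<open>add\<close> and \<open>mult\<close> serve maps that are additive and multiplicative only on
  such a span.\<close>

lemma poly_span_induct [consumes 2, case_names const var add mult]:
  assumes K: "subfield_set K" and z: "z \<in> poly_span K y m"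
    and const: "\<And>c. c \<in> K \<Longrightarrow> P c"
    and var: "\<And>i. i < m \<Longrightarrow> P (y i)"
    and add: "\<And>a b. a \<in> poly_span K y m \<Longrightarrow> b \<in> poly_span K y m \<Longrightarrow> P a \<Longrightarrow> P b \<Longrightarrow> P (a + b)"
    and mult: "\<And>a b. a \<in> poly_span K y m \<Longrightarrow> b \<in> poly_span K y m \<Longrightarrow> P a \<Longrightarrow> P b \<Longrightarrow> P (a * b)"
  shows "P z"
proof -
  obtain S c where S: "finite S" "\<forall>M\<in>S. set_mset M \<subseteq> {..<m} \<and> c M \<in> K" "z = (\<Sum>M\<in>S. c M * mono y M)"
    using z unfolding poly_span_def by blast
  have mon: "P (mono y M)" if "set_mset M \<subseteq> {..<m}" for M
    using that
  proof (induction M)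
    case empty
    then show ?case using const[OF subfield_setD(2)[OF K]] by simp
  next
    case (add i M)
    have "mono y M \<in> poly_span K y m"
      using poly_span_monoI[of 1 K M m y] add subfield_setD(2)[OF K] by simp
    then show ?case using add by (auto intro!: mult var poly_span_var K)
  qed
  have mem: "mono y M \<in> poly_span K y m" if "set_mset M \<subseteq> {..<m}" for M
    using poly_span_monoI[of 1 K M m y] that subfield_setD(2)[OF K] by simp
  have "P (\<Sum>M\<in>S. c M * mono y M)" using S(1,2)
  proof (induction S rule: finite_induct)
    case empty
    then show ?case using const[OF subfield_setD(1)[OF K]] by simp
  next
    case (insert M S)
    have "(\<Sum>M\<in>S. c M * mono y M) \<in> poly_span K y m"
      using insert by (intro poly_span_sum[OF K] poly_span_monoI) auto
    moreover have "c M * mono y M \<in> poly_span K y m" "P (c M * mono y M)"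
      using insert by (auto intro: poly_span_monoI mult const mon mem poly_span_const)
    ultimately show ?case using insert by (simp add: add)
  qed
  then show ?thesis using S(3) by simp
qed

text \<open>After adjoining one variable, only that variable needs a new check. In the applications
  \<open>R\<close> is the set of elements of the larger span that have a property already known on
  the smaller one.\<close>

lemma poly_span_Suc_subset:
  assumes K: "subfield_set K" and sub: "poly_span K y m \<subseteq> R" and "y m \<in> R"
    and add: "\<And>a b. a \<in> R \<Longrightarrow> b \<in> R \<Longrightarrow> a + b \<in> R" and mult: "\<And>a b. a \<in> R \<Longrightarrow> b \<in> R \<Longrightarrow> a * b \<in> R"
  shows "poly_span K y (Suc m) \<subseteq> R"
proof
  fix z assume z: "z \<in> poly_span K y (Suc m)"
  show "z \<in> R" using K z
  proof (induction rule: poly_span_induct)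
    case (var i)
    then show ?case using \<open>y m \<in> R\<close> sub poly_span_var[OF K, of i m y] by (cases "i = m") auto
  next
    case (const c)
    then show ?case using sub poly_span_const by blast
  qed (auto intro: add mult)
qed

text \<open>Multiplying by \<open>x i ^ e\<close> adds \<open>e\<close> copies of \<open>i\<close>
  to each multiset. No two terms collide, because the multisets of the coefficients avoid
  \<open>i\<close>.\<close>

lemma alg_indep_power_sum_eq_0:
  fixes x :: "nat \<Rightarrow> 'a::comm_ring_1"
  assumes ind: "alg_indep K x n" and "i < n" and sum0: "(\<Sum>e<N. a e * x i ^ e) = 0"
    and a: "\<And>e. e < N \<Longrightarrow> a e \<in> poly_span K x i" and e: "e < N"
  shows "a e = 0"
proof -
  have "\<exists>S c. finite S \<and> (\<forall>M\<in>S. set_mset M \<subseteq> {..<i} \<and> c M \<in> K) \<and> a e = (\<Sum>M\<in>S. c M * mono x M)"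
    if "e < N" for e
    using a[OF that] unfolding poly_span_def by blast
  then obtain S c where S: "\<And>e. e < N \<Longrightarrow> finite (S e)"
      "\<And>e M. e < N \<Longrightarrow> M \<in> S e \<Longrightarrow> set_mset M \<subseteq> {..<i} \<and> c e M \<in> K"
      "\<And>e. e < N \<Longrightarrow> a e = (\<Sum>M\<in>S e. c e M * mono x M)"
    by metis
  define T where "T = Sigma {..<N} S"
  define f where "f = (\<lambda>(e, M). M + replicate_mset e i)"
  \<comment> \<open>Injectivity of \<open>f\<close> lets each coefficient be read off from the
    combined multiset.\<close>
  define g where "g M = (case inv_into T f M of (e, M') \<Rightarrow> c e M')" for M
  have fin: "finite T" using S(1) by (auto simp: T_def)
  have inj: "inj_on f T"
  proof (rule inj_onI, clarify)
    fix e M e' M' assume T: "(e, M) \<in> T" "(e', M') \<in> T" and eq: "f (e, M) = f (e', M')"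
    have "count M i = 0" "count M' i = 0"
      using T S(2)[of e M] S(2)[of e' M'] by (auto simp: T_def count_eq_zero_iff)
    moreover have "count (f (e, M)) i = count (f (e', M')) i" using eq by simp
    ultimately have "e = e'" by (simp add: f_def)
    then show "e = e' \<and> M = M'" using eq by (simp add: f_def)
  qed
  have g: "g (f (e, M)) = c e M" if "(e, M) \<in> T" for e M
    using inv_into_f_f[OF inj that] by (simp add: g_def)
  have "(\<Sum>M\<in>f ` T. g M * mono x M) = (\<Sum>p\<in>T. g (f p) * mono x (f p))"
    by (rule sum.reindex_cong[OF inj]) auto
  also have "\<dots> = (\<Sum>(e, M)\<in>T. c e M * mono x M * x i ^ e)"
    by (rule sum.cong) (auto simp: g, auto simp: f_def)
  also have "\<dots> = (\<Sum>e<N. \<Sum>M\<in>S e. c e M * mono x M * x i ^ e)"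
    unfolding T_def using S(1) by (subst sum.Sigma) auto
  also have "\<dots> = (\<Sum>e<N. a e * x i ^ e)"
    by (rule sum.cong) (auto simp: S(3) sum_distrib_right)
  finally have "(\<Sum>M\<in>f ` T. g M * mono x M) = 0" using sum0 by simp
  moreover have "\<forall>M\<in>f ` T. set_mset M \<subseteq> {..<n} \<and> g M \<in> K"
  proof (rule ballI)
    fix M' assume "M' \<in> f ` T"
    then obtain e M where p: "(e, M) \<in> T" "M' = f (e, M)" by auto
    then have "e < N" "M \<in> S e" by (auto simp: T_def)
    then have "set_mset M \<subseteq> {..<i}" "c e M \<in> K" using S(2) by auto
    moreover have "set_mset M' \<subseteq> insert i (set_mset M)" by (auto simp: p f_def split: if_splits)
    ultimately show "set_mset M' \<subseteq> {..<n} \<and> g M' \<in> K"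
      using \<open>i < n\<close> g[OF p(1)] p(2) by (auto dest!: subsetD)
  qed
  ultimately have "\<forall>M\<in>f ` T. g M = 0"
    using ind fin unfolding alg_indep_def by blast
  then have "c e M = 0" if "M \<in> S e" for M
    using g[of e M] that e by (auto simp: T_def)
  then show ?thesis using S(3)[OF e] by simp
qed

section \<open>Deleting one derivation\<close>

text \<open>Characteristic zero is an assumption, because the type of the field only carries the
  class \<open>field\<close>; for quotient fields it is derived from \<open>k\<close>.\<close>

locale poisson_field =
  fixes brF :: "'b::field \<Rightarrow> 'b \<Rightarrow> 'b"
  assumes poisson: "poisson_bracket brF"
    and of_nat_neq_0: "n > 0 \<Longrightarrow> of_nat n \<noteq> (0::'b)"
begin

lemma add_left: "brF (a + b) c = brF a c + brF b c"
  and skew: "brF a b = - brF b a"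
  and mult_right: "brF a (b * c) = brF a b * c + b * brF a c"
  using poisson unfolding poisson_bracket_def by blast+

lemma add_right: "brF a (b + c) = brF a b + brF a c"
  using skew[of a "b + c"] skew[of a b] skew[of a c] by (simp add: add_left)

lemma zero_right [simp]: "brF a 0 = 0"
  by (metis add_right add_0_right add_cancel_left_right)

lemma zero_left [simp]: "brF 0 a = 0"
  using skew[of 0 a] by simp

lemma one_right [simp]: "brF a 1 = 0"
  by (metis mult_right mult_1_left mult_1_right add_cancel_left_right)

lemma one_left [simp]: "brF 1 a = 0"
  using skew[of 1 a] by simp

lemma self [simp]: "brF a a = 0"
proof -
  have "of_nat 2 * brF a a = 0"
    using skew[of a a] by (metis eq_neg_iff_add_eq_0 mult_2 of_nat_numeral)
  then show ?thesis using of_nat_neq_0[of 2] by (metis mult_eq_0_iff zero_less_numeral)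
qed

lemma minus_right: "brF a (- b) = - brF a b"
  using add_right[of a b "- b"] by (simp add: eq_neg_iff_add_eq_0 add.commute)

lemma of_nat_right [simp]: "brF a (of_nat n) = 0"
  by (induction n) (auto simp: add_right)

lemma sum_right: "brF a (sum f S) = (\<Sum>i\<in>S. brF a (f i))"
  by (induction S rule: infinite_finite_induct) (auto simp: add_right)

lemma divide_right:
  assumes "c \<noteq> 0"
  shows "brF a (b / c) = (brF a b * c - b * brF a c) / (c * c)"
proof -
  have "brF a b = brF a (b / c) * c + b / c * brF a c"
    using mult_right[of a "b / c" c] assms by simp
  then show ?thesis using assms by (simp add: field_simps)
qed

lemma central_mult_right: "brF a c = 0 \<Longrightarrow> brF a (c * b) = c * brF a b"
  by (simp add: mult_right)

lemma divide_of_nat_right: "brF a (b / of_nat n) = brF a b / of_nat n"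
proof (cases "of_nat n = (0::'b)")
  case False
  then show ?thesis by (simp add: divide_right)
qed simp

text \<open>This reduces centrality of an element to its brackets with generators of the
  field.\<close>

lemma subfield_set_centralizer: "subfield_set {c. brF a c = 0}"
proof -
  have "\<exists>b. brF a b = 0 \<and> c * b = 1" if "brF a c = 0" "c \<noteq> 0" for c
    using that divide_right[of c a 1] by (intro exI[of _ "1 / c"]) auto
  then show ?thesis
    unfolding subfield_set_def by (auto simp: add_right mult_right minus_right)
qed

definition center :: "'b set" where
  "center = {c. \<forall>a. brF a c = 0}"

lemma subfield_set_center: "subfield_set center"
proof -
  have "\<exists>b. (\<forall>a. brF a b = 0) \<and> c * b = 1" if "\<forall>a. brF a c = 0" "c \<noteq> 0" for c
    using that divide_right[of c _ 1] by (intro exI[of _ "1 / c"]) auto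
  then show ?thesis
    unfolding subfield_set_def center_def by (auto simp: add_right mult_right minus_right)
qed

lemma center_right [simp]: "c \<in> center \<Longrightarrow> brF a c = 0"
  by (simp add: center_def)

lemma center_left [simp]: "c \<in> center \<Longrightarrow> brF c a = 0"
  using skew[of c a] by simp

text \<open>The chain rule for the derivation \<open>brF u\<close>, which acts both on the
  coefficients of \<open>p\<close> and on the point \<open>t\<close>.\<close>

lemma poly_right:
  "brF u (poly p t) = poly (map_poly (brF u) p) t + poly (pderiv p) t * brF u t"
  by (induction p) (auto simp: add_right mult_right map_poly_pCons pderiv_pCons algebra_simps)

end

text \<open>Pascal's rule, for an arbitrary doubly indexed family so that it drives the Leibniz
  formulas for products and for brackets alike.\<close>

lemma binomial_sum_Suc:
  fixes u :: "nat \<Rightarrow> nat \<Rightarrow> 'a::comm_semiring_1"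
  shows "(\<Sum>l\<le>Suc N. of_nat (Suc N choose l) * u l (Suc N - l)) =
    (\<Sum>l\<le>N. of_nat (N choose l) * u (Suc l) (N - l)) + (\<Sum>l\<le>N. of_nat (N choose l) * u l (Suc (N - l)))"
proof -
  let ?A = "\<Sum>l\<le>N. of_nat (N choose l) * u (Suc l) (N - l)"
  let ?C = "\<Sum>l\<le>N. of_nat (N choose Suc l) * u (Suc l) (N - l)"
  have 1: "(\<Sum>l\<le>Suc N. of_nat (Suc N choose l) * u l (Suc N - l)) = ?A + (?C + u 0 (Suc N))"
    by (subst sum.atMost_Suc_shift) (simp add: sum.distrib algebra_simps)
  have 2: "?C + u 0 (Suc N) = (\<Sum>l\<le>Suc N. of_nat (N choose l) * u l (Suc N - l))"
    by (subst sum.atMost_Suc_shift) (simp add: add.commute)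
  have 3: "(\<Sum>l\<le>Suc N. of_nat (N choose l) * u l (Suc N - l)) =
      (\<Sum>l\<le>N. of_nat (N choose l) * u l (Suc (N - l)))"
    by (simp add: Suc_diff_le binomial_eq_0)
  show ?thesis unfolding 1 2 3 ..
qed

text \<open>One deletion step, detached from the tower. \<open>B\<close> is the coefficient algebra
  and \<open>z\<close> the image of the variable adjoined to it, possibly zero.\<close>

locale deleting_derivation = poisson_field brF
  for brF :: "'b::field \<Rightarrow> 'b \<Rightarrow> 'b" +
  fixes B :: "'a::comm_ring_1 set" and br :: "'a \<Rightarrow> 'a \<Rightarrow> 'a" and \<alpha> \<delta> :: "'a \<Rightarrow> 'a"
    and \<theta> :: "'a \<Rightarrow> 'b" and z :: 'b and s :: 'a
  assumes br_add_left: "br (a + b) c = br a c + br b c"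
    and br_add_right: "br a (b + c) = br a b + br a c"
    and B_0 [intro, simp]: "0 \<in> B"
    and B_add [intro]: "a \<in> B \<Longrightarrow> b \<in> B \<Longrightarrow> a + b \<in> B"
    and B_diff [intro]: "a \<in> B \<Longrightarrow> b \<in> B \<Longrightarrow> a - b \<in> B"
    and B_mult [intro]: "a \<in> B \<Longrightarrow> b \<in> B \<Longrightarrow> a * b \<in> B"
    and B_br [intro]: "a \<in> B \<Longrightarrow> b \<in> B \<Longrightarrow> br a b \<in> B"
    and B_\<alpha> [intro]: "a \<in> B \<Longrightarrow> \<alpha> a \<in> B"
    and B_\<delta> [intro]: "a \<in> B \<Longrightarrow> \<delta> a \<in> B"
    and B_s [intro, simp]: "s \<in> B"
    and \<delta>_add: "a \<in> B \<Longrightarrow> b \<in> B \<Longrightarrow> \<delta> (a + b) = \<delta> a + \<delta> b"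
    and \<delta>_mult: "a \<in> B \<Longrightarrow> b \<in> B \<Longrightarrow> \<delta> (a * b) = \<delta> a * b + a * \<delta> b"
    and \<delta>_s: "b \<in> B \<Longrightarrow> \<delta> (s * b) = s * \<delta> b"
    and \<delta>_br: "a \<in> B \<Longrightarrow> b \<in> B \<Longrightarrow>
      \<delta> (br a b) = br (\<delta> a) b + br a (\<delta> b) + (\<alpha> a * \<delta> b - \<delta> a * \<alpha> b)"
    and \<alpha>_\<delta>: "b \<in> B \<Longrightarrow> \<alpha> (\<delta> b) = \<delta> (\<alpha> b) + s * \<delta> b"
    and nilpotent: "b \<in> B \<Longrightarrow> \<exists>N. (\<delta> ^^ N) b = 0"
    and \<theta>_add: "a \<in> B \<Longrightarrow> b \<in> B \<Longrightarrow> \<theta> (a + b) = \<theta> a + \<theta> b"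
    and \<theta>_mult: "a \<in> B \<Longrightarrow> b \<in> B \<Longrightarrow> \<theta> (a * b) = \<theta> a * \<theta> b"
    and \<theta>_br: "a \<in> B \<Longrightarrow> b \<in> B \<Longrightarrow> \<theta> (br a b) = brF (\<theta> a) (\<theta> b)"
    and \<theta>_s: "\<theta> s \<in> center" "\<theta> s \<noteq> 0"
    and z: "b \<in> B \<Longrightarrow> brF z (\<theta> b) = \<theta> (\<alpha> b) * z + \<theta> (\<delta> b)"
begin

text \<open>If \<open>z = 0\<close> then \<open>t = 0\<close>, and the map \<open>\<theta>'\<close> below agrees with \<open>\<theta>\<close>.\<close>
definition t :: 'b where
  "t = - 1 / (\<theta> s * z)"

text \<open>The exponential series of \<delta> in a formal variable. Evaluation at \<open>t\<close>
  is postponed so that identities can be verified coefficient by coefficient. Local nilpotency gives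
  the finite support that \<open>Abs_poly\<close> requires.\<close>

definition expansion :: "'a \<Rightarrow> 'b poly" where
  "expansion b = Abs_poly (\<lambda>l. \<theta> ((\<delta> ^^ l) b) / of_nat (fact l))"

definition \<theta>' :: "'a \<Rightarrow> 'b" where
  "\<theta>' b = poly (expansion b) t"

text \<open>The defect of \<delta> from being a Poisson derivation.\<close>

definition twist :: "'a \<Rightarrow> 'a \<Rightarrow> 'a" where
  "twist a b = \<alpha> a * \<delta> b - \<delta> a * \<alpha> b"

lemma fact_neq_0 [simp]: "of_nat (fact l) \<noteq> (0::'b)"
  by (simp add: of_nat_neq_0)

lemma divide_fact_Suc: "of_nat (Suc l) * u / of_nat (fact (Suc l)) = (u / of_nat (fact l) :: 'b)"
proof -
  have "of_nat (Suc l) \<noteq> (0::'b)" using of_nat_neq_0 by blast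
  moreover have "of_nat (fact (Suc l)) = (of_nat (Suc l) * of_nat (fact l) :: 'b)"
    by (simp only: fact_Suc of_nat_mult of_nat_id)
  ultimately show ?thesis by (simp del: of_nat_Suc fact_Suc)
qed

lemma \<theta>_0 [simp]: "\<theta> 0 = 0"
  by (metis \<theta>_add B_0 add_0_right add_cancel_left_right)

lemma \<theta>_diff: "a \<in> B \<Longrightarrow> b \<in> B \<Longrightarrow> \<theta> (a - b) = \<theta> a - \<theta> b"
  using \<theta>_add[of "a - b" b] B_diff[of a b] by (simp add: eq_diff_eq)

lemma \<delta>_0 [simp]: "\<delta> 0 = 0"
  by (metis \<delta>_add B_0 add_0_right add_cancel_left_right)

lemma \<delta>_diff: "a \<in> B \<Longrightarrow> b \<in> B \<Longrightarrow> \<delta> (a - b) = \<delta> a - \<delta> b"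
  using \<delta>_add[of "a - b" b] B_diff[of a b] by (simp add: eq_diff_eq)

section \<open>Iterates of the locally nilpotent derivation\<close>

lemma B_pow [intro]: "b \<in> B \<Longrightarrow> (\<delta> ^^ l) b \<in> B"
  by (induction l) auto

lemma B_twist [intro]: "a \<in> B \<Longrightarrow> b \<in> B \<Longrightarrow> twist a b \<in> B"
  by (auto simp: twist_def)

lemma pow_0 [simp]: "(\<delta> ^^ l) 0 = 0"
  by (induction l) auto

lemma pow_add: "a \<in> B \<Longrightarrow> b \<in> B \<Longrightarrow> (\<delta> ^^ l) (a + b) = (\<delta> ^^ l) a + (\<delta> ^^ l) b"
  by (induction l) (auto simp: \<delta>_add B_pow)

lemma pow_eq_0_mono: "N \<le> l \<Longrightarrow> (\<delta> ^^ N) b = 0 \<Longrightarrow> (\<delta> ^^ l) b = 0"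
  by (induction rule: dec_induct) auto

lemma pow_mult:
  "a \<in> B \<Longrightarrow> b \<in> B \<Longrightarrow>
    (\<delta> ^^ N) (a * b) = (\<Sum>l\<le>N. of_nat (N choose l) * ((\<delta> ^^ l) a * (\<delta> ^^ (N - l)) b))"
proof (induction N arbitrary: a b)
  case (Suc N)
  have "(\<delta> ^^ Suc N) (a * b) = (\<delta> ^^ N) (\<delta> a * b) + (\<delta> ^^ N) (a * \<delta> b)"
    using Suc.prems by (simp add: funpow_Suc_right \<delta>_mult pow_add B_mult B_\<delta> del: funpow.simps)
  also have "\<dots> = (\<Sum>l\<le>Suc N. of_nat (Suc N choose l) * ((\<delta> ^^ l) a * (\<delta> ^^ (Suc N - l)) b))"
    unfolding binomial_sum_Suc[where u = "\<lambda>l m. (\<delta> ^^ l) a * (\<delta> ^^ m) b"]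
    using Suc.prems by (simp add: Suc.IH B_\<delta> funpow_Suc_right del: funpow.simps)
  finally show ?case .
qed simp

text \<open>Moving \<alpha> past \<delta> produces two terms
  \<open>s * \<delta> a * \<delta> b\<close> of opposite sign, which cancel.\<close>

lemma \<delta>_twist:
  assumes "a \<in> B" "b \<in> B"
  shows "\<delta> (twist a b) = twist (\<delta> a) b + twist a (\<delta> b)"
  unfolding twist_def using assms
  by (simp add: \<delta>_diff \<delta>_mult \<alpha>_\<delta> B_mult B_\<delta> B_\<alpha> algebra_simps)

text \<open>Besides the Leibniz sum, each of the \<open>N\<close> applications of \<delta>
  contributes one correction, and \<open>\<delta>_twist\<close> makes all of them equal to the same
  iterate of \<open>twist a b\<close>. At \<open>N = 0\<close> the truncated exponent
  \<open>N - 1\<close> is harmless because of the factor \<open>N\<close>.\<close>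

lemma pow_br:
  "a \<in> B \<Longrightarrow> b \<in> B \<Longrightarrow>
    (\<delta> ^^ N) (br a b) = (\<Sum>l\<le>N. of_nat (N choose l) * br ((\<delta> ^^ l) a) ((\<delta> ^^ (N - l)) b))
      + of_nat N * (\<delta> ^^ (N - 1)) (twist a b)"
proof (induction N arbitrary: a b)
  case (Suc N)
  have tw: "of_nat N * ((\<delta> ^^ (N - 1)) (twist (\<delta> a) b) + (\<delta> ^^ (N - 1)) (twist a (\<delta> b))) =
      of_nat N * (\<delta> ^^ N) (twist a b)"
    using Suc.prems
    by (cases N) (simp_all add: pow_add[symmetric] \<delta>_twist[symmetric] B_twist B_\<delta> funpow_Suc_right del: funpow.simps(2))
  have "(\<delta> ^^ Suc N) (br a b) = (\<delta> ^^ N) (br (\<delta> a) b) + (\<delta> ^^ N) (br a (\<delta> b)) + (\<delta> ^^ N) (twist a b)"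
    using Suc.prems
    by (simp add: funpow_Suc_right \<delta>_br pow_add B_br B_\<delta> B_add B_twist twist_def[symmetric] del: funpow.simps)
  also have "\<dots> = (\<Sum>l\<le>Suc N. of_nat (Suc N choose l) * br ((\<delta> ^^ l) a) ((\<delta> ^^ (Suc N - l)) b))
      + of_nat N * ((\<delta> ^^ (N - 1)) (twist (\<delta> a) b) + (\<delta> ^^ (N - 1)) (twist a (\<delta> b))) + (\<delta> ^^ N) (twist a b)"
    unfolding binomial_sum_Suc[where u = "\<lambda>l m. br ((\<delta> ^^ l) a) ((\<delta> ^^ m) b)"]
    using Suc.prems by (simp add: Suc.IH B_\<delta> funpow_Suc_right algebra_simps del: funpow.simps)
  finally show ?case unfolding tw by (simp add: algebra_simps)
qed simp

text \<open>Moving \<beta> past each \<delta> costs one \<kappa>. The general form serves twice: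
  with \<alpha> and \<open>s\<close> of the current variable, and with \<open>\<alpha> j\<close> and
  \<open>lam j i\<close> of a later one.\<close>

lemma intertwine_pow:
  assumes \<beta>: "\<And>b. b \<in> B \<Longrightarrow> \<beta> b \<in> B" "\<And>b. b \<in> B \<Longrightarrow> \<beta> (\<delta> b) = \<delta> (\<beta> b) + \<kappa> * \<delta> b"
    and \<kappa>: "\<kappa> \<in> B" "\<And>b. b \<in> B \<Longrightarrow> \<delta> (\<kappa> * b) = \<kappa> * \<delta> b"
    and b: "b \<in> B"
  shows "\<beta> ((\<delta> ^^ l) b) = (\<delta> ^^ l) (\<beta> b) + of_nat l * (\<kappa> * (\<delta> ^^ l) b)"
proof (induction l)
  case (Suc l)
  have nat: "of_nat n * c \<in> B \<and> \<delta> (of_nat n * c) = of_nat n * \<delta> c" if "c \<in> B" for n c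
    using that by (induction n) (auto simp: \<delta>_add distrib_right)
  have "\<kappa> * (\<delta> ^^ l) b \<in> B" "(\<delta> ^^ l) (\<beta> b) \<in> B" using b \<beta>(1) \<kappa>(1) by auto
  moreover have "\<beta> ((\<delta> ^^ Suc l) b) = \<delta> ((\<delta> ^^ l) (\<beta> b) + of_nat l * (\<kappa> * (\<delta> ^^ l) b)) + \<kappa> * (\<delta> ^^ Suc l) b"
    using Suc b by (simp add: \<beta> B_pow)
  ultimately have "\<beta> ((\<delta> ^^ Suc l) b) = (\<delta> ^^ Suc l) (\<beta> b) + of_nat l * (\<kappa> * (\<delta> ^^ Suc l) b) + \<kappa> * (\<delta> ^^ Suc l) b"
    using b by (simp add: \<delta>_add nat \<kappa> B_pow)
  then show ?case by (simp add: algebra_simps)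
qed simp

lemma \<alpha>_pow: "b \<in> B \<Longrightarrow> \<alpha> ((\<delta> ^^ l) b) = (\<delta> ^^ l) (\<alpha> b) + of_nat l * (s * (\<delta> ^^ l) b)"
  by (rule intertwine_pow) (auto simp: \<alpha>_\<delta> \<delta>_s)

lemma coeff_expansion: "b \<in> B \<Longrightarrow> coeff (expansion b) l = \<theta> ((\<delta> ^^ l) b) / of_nat (fact l)"
proof -
  assume "b \<in> B"
  then obtain N where "(\<delta> ^^ N) b = 0" using nilpotent by blast
  then show ?thesis
    unfolding expansion_def by (subst coeff_Abs_poly[of N]) (auto simp: pow_eq_0_mono[of N])
qed

lemma \<theta>_of_nat_mult: "b \<in> B \<Longrightarrow> of_nat n * b \<in> B \<and> \<theta> (of_nat n * b) = of_nat n * \<theta> b"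
  by (induction n) (auto simp: \<theta>_add distrib_right)

lemma \<theta>_sum: "(\<And>i. i \<in> S \<Longrightarrow> f i \<in> B) \<Longrightarrow> sum f S \<in> B \<and> \<theta> (sum f S) = (\<Sum>i\<in>S. \<theta> (f i))"
  by (induction S rule: infinite_finite_induct) (auto simp: \<theta>_add)

text \<open>Dividing by \<open>fact N\<close> turns the binomial coefficient into
  \<open>1 / (fact l * fact (N - l))\<close>, so Leibniz formulas become Cauchy products of
  exponential series.\<close>

lemma \<theta>_binomial_sum:
  assumes "\<And>l. u l \<in> B"
  shows "\<theta> (\<Sum>l\<le>N. of_nat (N choose l) * u l) / of_nat (fact N) =
    (\<Sum>l\<le>N. \<theta> (u l) / (of_nat (fact l) * of_nat (fact (N - l))))"
proof -
  have "of_nat (N choose l) * \<theta> (u l) / of_nat (fact N) = \<theta> (u l) / (of_nat (fact l) * of_nat (fact (N - l)))"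
    if "l \<le> N" for l
  proof -
    have "of_nat (fact N) = (of_nat (fact l) * of_nat (fact (N - l)) * of_nat (N choose l) :: 'b)"
      using arg_cong[OF binomial_fact_lemma[OF that], of "of_nat :: nat \<Rightarrow> 'b"] by simp
    moreover from this have "of_nat (N choose l) \<noteq> (0::'b)" by (metis fact_neq_0 mult_zero_right)
    ultimately show ?thesis by simp
  qed
  then show ?thesis
    using assms by (simp add: \<theta>_sum \<theta>_of_nat_mult sum_divide_distrib)
qed

lemma expansion_add: "a \<in> B \<Longrightarrow> b \<in> B \<Longrightarrow> expansion (a + b) = expansion a + expansion b"
  by (rule poly_eqI) (simp add: coeff_expansion pow_add \<theta>_add B_add B_pow add_divide_distrib)

lemma expansion_mult:
  assumes "a \<in> B" "b \<in> B"
  shows "expansion (a * b) = expansion a * expansion b"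
  using assms
  by (intro poly_eqI) (auto simp: coeff_expansion coeff_mult pow_mult \<theta>_binomial_sum B_mult B_pow \<theta>_mult intro!: sum.cong)

lemma pderiv_expansion: "b \<in> B \<Longrightarrow> pderiv (expansion b) = expansion (\<delta> b)"
proof (rule poly_eqI)
  fix l assume b: "b \<in> B"
  show "coeff (pderiv (expansion b)) l = coeff (expansion (\<delta> b)) l"
    using b divide_fact_Suc[of l "\<theta> ((\<delta> ^^ Suc l) b)"]
    by (simp add: coeff_pderiv coeff_expansion B_\<delta> funpow_swap1 del: of_nat_Suc fact_Suc)
qed

section \<open>The new homomorphism and its brackets\<close>

lemma \<theta>'_add: "a \<in> B \<Longrightarrow> b \<in> B \<Longrightarrow> \<theta>' (a + b) = \<theta>' a + \<theta>' b"
  by (simp add: \<theta>'_def expansion_add)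

lemma \<theta>'_mult: "a \<in> B \<Longrightarrow> b \<in> B \<Longrightarrow> \<theta>' (a * b) = \<theta>' a * \<theta>' b"
  by (simp add: \<theta>'_def expansion_mult)

lemma \<theta>'_diff: "a \<in> B \<Longrightarrow> b \<in> B \<Longrightarrow> \<theta>' (a - b) = \<theta>' a - \<theta>' b"
  using \<theta>'_add[of "a - b" b] B_diff[of a b] by (simp add: eq_diff_eq)

text \<open>Only the constant term of the expansion survives. Hence deletion leaves the constants
  from \<open>k\<close> fixed.\<close>

lemma \<theta>'_if_\<delta>_0: "b \<in> B \<Longrightarrow> \<delta> b = 0 \<Longrightarrow> \<theta>' b = \<theta> b"
proof -
  assume b: "b \<in> B" "\<delta> b = 0"
  then have "expansion b = [:\<theta> b:]"
    by (intro poly_eqI) (auto simp: coeff_expansion coeff_pCons funpow_Suc_right simp del: funpow.simps(2) split: nat.split)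
  then show ?thesis by (simp add: \<theta>'_def)
qed

text \<open>For nonzero \<open>z\<close> this is the quotient rule, with \<open>\<theta> s\<close>
  central. Writing the result in terms of \<open>t\<close> gives a formula that also holds for
  \<open>z = 0\<close>, where both sides vanish.\<close>

lemma bracket_t:
  assumes c: "c \<in> B"
  shows "brF (\<theta> c) t = t * \<theta> (\<alpha> c) - \<theta> s * t ^ 2 * \<theta> (\<delta> c)"
proof (cases "z = 0")
  case False
  have br: "brF (\<theta> c) (\<theta> s * z) = - \<theta> s * (\<theta> (\<alpha> c) * z + \<theta> (\<delta> c))"
    using skew[of "\<theta> c" z] c \<theta>_s(1) by (simp add: central_mult_right z right_diff_distrib distrib_left)
  have nz: "\<theta> s * z \<noteq> 0" using False \<theta>_s(2) by simp
  show ?thesis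
    using False \<theta>_s(2) unfolding t_def divide_right[OF nz] br minus_right one_right
    by (simp add: field_simps power2_eq_square)
next
  case True
  then have "t = 0" unfolding t_def by simp
  then show ?thesis by simp
qed

text \<open>The derivative of the series times the variable is the Euler operator, which brings down
  the factor \<open>l\<close>.\<close>

lemma coeff_shift_expansion:
  assumes "a \<in> B"
  shows "coeff (pCons 0 (smult c (expansion (\<delta> a)))) l = c * (of_nat l * \<theta> ((\<delta> ^^ l) a) / of_nat (fact l))"
proof (cases l)
  case (Suc m)
  then show ?thesis
    using assms divide_fact_Suc[of m "\<theta> ((\<delta> ^^ Suc m) a)"]
    by (simp add: coeff_expansion B_\<delta> funpow_swap1 del: of_nat_Suc fact_Suc)
qed simp

text \<open>Inserting \<open>\<alpha>_pow\<close> into \<open>bracket_t\<close> produces an Euler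
  term with factor \<open>l * \<theta> s\<close>. At the point \<open>t\<close> it cancels the term
  quadratic in \<open>t\<close>.\<close>

lemma twisted_bracket_poly:
  assumes a: "a \<in> B" and p: "\<And>l. coeff p l = brF (\<theta> ((\<delta> ^^ l) a)) t / of_nat (fact l)"
  shows "poly p t = t * \<theta>' (\<alpha> a)"
proof -
  have pq: "p = smult t (expansion (\<alpha> a) + smult (\<theta> s) (pCons 0 (expansion (\<delta> a))))
      - smult (\<theta> s * t ^ 2) (expansion (\<delta> a))" (is "_ = ?q")
  proof (rule poly_eqI)
    fix l
    have nat: "\<theta> (of_nat l * (s * (\<delta> ^^ l) a)) = of_nat l * (\<theta> s * \<theta> ((\<delta> ^^ l) a))"
        "of_nat l * (s * (\<delta> ^^ l) a) \<in> B"
      using a by (simp_all add: \<theta>_of_nat_mult B_mult B_pow \<theta>_mult)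
    show "coeff p l = coeff ?q l"
      unfolding p bracket_t[OF B_pow[OF a]] \<alpha>_pow[OF a]
      using a nat by (simp add: coeff_shift_expansion coeff_expansion B_\<alpha> B_\<delta> B_pow \<theta>_add funpow_swap1
          add_divide_distrib diff_divide_distrib algebra_simps del: funpow.simps)
  qed
  show ?thesis unfolding pq by (simp add: \<theta>'_def algebra_simps power2_eq_square)
qed

lemma bracket_\<theta>'_left:
  assumes a: "a \<in> B"
  shows "brF (\<theta>' a) w = poly (map_poly (\<lambda>u. brF u w) (expansion a)) t + \<theta>' (\<delta> a) * brF t w"
proof -
  have "map_poly (\<lambda>u. brF u w) (expansion a) = - map_poly (brF w) (expansion a)"
    by (intro poly_eqI) (simp add: coeff_map_poly skew[of _ w])
  then show ?thesis
    using poly_right[of w "expansion a" t] pderiv_expansion[OF a] skew[of "\<theta>' a" w] skew[of t w]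
    by (simp add: \<theta>'_def)
qed

lemma bracket_divide_left: "brF (u / of_nat n) w = brF u w / of_nat n"
  using skew[of "u / of_nat n" w] skew[of u w] divide_of_nat_right[of w u n] by simp

text \<open>The chain rule adds a multiple of \<open>brF t t\<close>, which is zero, so only the
  coefficientwise brackets remain.\<close>

lemma bracket_\<theta>'_t: "a \<in> B \<Longrightarrow> brF (\<theta>' a) t = t * \<theta>' (\<alpha> a)"
  by (subst bracket_\<theta>'_left, assumption, simp, rule twisted_bracket_poly)
    (simp_all add: coeff_map_poly coeff_expansion bracket_divide_left)

text \<open>For nonzero \<open>z\<close> the product \<open>\<theta> s * (t * z)\<close> is the
  constant -1, so the bracket with \<open>t\<close> determines the bracket with
  \<open>z\<close>.\<close>

lemma bracket_z_\<theta>':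
  assumes a: "a \<in> B"
  shows "brF z (\<theta>' a) = \<theta>' (\<alpha> a) * z"
proof (cases "z = 0")
  case False
  then have "\<theta> s * (t * z) = - 1" "t \<noteq> 0" using \<theta>_s(2) by (auto simp: t_def)
  then have "brF (\<theta>' a) (\<theta> s * (t * z)) = 0" by (simp add: minus_right)
  then have "\<theta> s * (t * (\<theta>' (\<alpha> a) * z + brF (\<theta>' a) z)) = 0"
    using \<theta>_s(1) bracket_\<theta>'_t[OF a] by (simp add: mult_right algebra_simps)
  then have "\<theta>' (\<alpha> a) * z = - brF (\<theta>' a) z" unfolding eq_neg_iff_add_eq_0 using \<open>t \<noteq> 0\<close> \<theta>_s(2) by simp
  then show ?thesis by (simp add: skew[of z "\<theta>' a"])
qed simp

definition partial_bracket :: "'a \<Rightarrow> 'a \<Rightarrow> 'b poly" where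
  "partial_bracket a c = map_poly (\<lambda>u. brF u (\<theta> c)) (expansion a)"

lemma coeff_partial_bracket:
  "a \<in> B \<Longrightarrow> c \<in> B \<Longrightarrow> coeff (partial_bracket a c) l = \<theta> (br ((\<delta> ^^ l) a) c) / of_nat (fact l)"
  by (simp add: partial_bracket_def coeff_map_poly coeff_expansion bracket_divide_left \<theta>_br B_pow)

text \<open>The chain rule in both arguments yields the coefficientwise bracket \<open>W\<close> and
  two cross terms from differentiating \<open>t\<close>. By \<open>pow_br\<close>, \<open>W\<close>
  is the expansion of \<open>br a b\<close> minus the shifted expansion of \<open>twist a b\<close>,
  and the value of the latter at \<open>t\<close> accounts exactly for the cross terms.\<close>

lemma bracket_\<theta>':
  assumes a: "a \<in> B" and b: "b \<in> B"
  shows "brF (\<theta>' a) (\<theta>' b) = \<theta>' (br a b)"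
proof -
  obtain L where L: "(\<delta> ^^ L) b = 0" using nilpotent b by blast
  \<comment> \<open>Exponential polynomials cut off at the nilpotency index of \<open>b\<close>, so
    that brackets of the coefficients can be expanded inside a finite sum.\<close>
  define q where "q c = (\<Sum>m<L. monom (c m / of_nat (fact m)) m)" for c :: "nat \<Rightarrow> 'b"
  have coeff_q: "coeff (q c) m = c m / of_nat (fact m)" if "\<And>m. m \<ge> L \<Longrightarrow> c m = 0" for c m
    using that by (auto simp: q_def coeff_sum if_distrib sum.delta' cong: if_cong)
  define W where "W = (\<Sum>m<L. monom (1 / of_nat (fact m)) m * partial_bracket a ((\<delta> ^^ m) b))"
  have W: "W = expansion (br a b) - pCons 0 (expansion (twist a b))"
  proof (rule poly_eqI)
    fix N
    have "coeff W N = (\<Sum>m<L. if m \<le> N then \<theta> (br ((\<delta> ^^ (N - m)) a) ((\<delta> ^^ m) b)) / (of_nat (fact m) * of_nat (fact (N - m))) else 0)"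
      unfolding W_def coeff_sum using a b
      by (intro sum.cong) (auto simp: coeff_monom_mult coeff_partial_bracket B_pow)
    also have "\<dots> = (\<Sum>m\<le>N. \<theta> (br ((\<delta> ^^ (N - m)) a) ((\<delta> ^^ m) b)) / (of_nat (fact m) * of_nat (fact (N - m))))"
    proof -
      have "br c 0 = 0" for c using br_add_right[of c 0 0] by simp
      then have "\<theta> (br ((\<delta> ^^ (N - m)) a) ((\<delta> ^^ m) b)) = 0" if "m \<ge> L" for m
        using pow_eq_0_mono[OF that L] by simp
      then show ?thesis
        by (intro sum.mono_neutral_cong) (auto simp: not_less)
    qed
    also have "\<dots> = (\<Sum>l\<le>N. \<theta> (br ((\<delta> ^^ l) a) ((\<delta> ^^ (N - l)) b)) / (of_nat (fact l) * of_nat (fact (N - l))))"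
      by (rule sum.reindex_bij_witness[of _ "\<lambda>l. N - l" "\<lambda>l. N - l"]) (auto simp: mult.commute)
    also have "\<dots> = \<theta> (\<Sum>l\<le>N. of_nat (N choose l) * br ((\<delta> ^^ l) a) ((\<delta> ^^ (N - l)) b)) / of_nat (fact N)"
      using a b by (subst \<theta>_binomial_sum) auto
    also have "(\<Sum>l\<le>N. of_nat (N choose l) * br ((\<delta> ^^ l) a) ((\<delta> ^^ (N - l)) b)) =
        (\<delta> ^^ N) (br a b) - of_nat N * (\<delta> ^^ (N - 1)) (twist a b)"
      using pow_br[OF a b] by simp
    also have "\<theta> \<dots> / of_nat (fact N) = coeff (expansion (br a b)) N - of_nat N * \<theta> ((\<delta> ^^ (N - 1)) (twist a b)) / of_nat (fact N)"
      using a b by (simp add: \<theta>_diff \<theta>_of_nat_mult B_pow B_br B_twist coeff_expansion diff_divide_distrib)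
    also have "of_nat N * \<theta> ((\<delta> ^^ (N - 1)) (twist a b)) / of_nat (fact N) = coeff (pCons 0 (expansion (twist a b))) N"
    proof (cases N)
      case (Suc m)
      then show ?thesis
        using a b divide_fact_Suc[of m "\<theta> ((\<delta> ^^ m) (twist a b))"]
        by (simp add: coeff_expansion B_twist del: of_nat_Suc fact_Suc)
    qed simp
    finally show "coeff W N = coeff (expansion (br a b) - pCons 0 (expansion (twist a b))) N" by simp
  qed
  \<comment> \<open>Up to the factor \<open>\<theta>' (\<delta> a)\<close>, \<open>V\<close>
    collects what arises from differentiating \<open>t\<close> inside
    \<open>\<theta>' a\<close>.\<close>
  define V where "V = q (\<lambda>m. brF (\<theta> ((\<delta> ^^ m) b)) t)"
  have zero: "\<theta> ((\<delta> ^^ m) b) = 0" if "m \<ge> L" for m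
    using pow_eq_0_mono[OF that L] by simp
  have V: "poly V t = t * \<theta>' (\<alpha> b)"
    using b zero by (intro twisted_bracket_poly) (simp_all add: V_def coeff_q)
  have map: "map_poly (brF (\<theta>' a)) (expansion b) = q (\<lambda>m. brF (\<theta>' a) (\<theta> ((\<delta> ^^ m) b)))"
    using b zero by (intro poly_eqI) (simp add: coeff_q coeff_map_poly coeff_expansion divide_of_nat_right)
  have br_left: "brF (\<theta>' a) (\<theta> ((\<delta> ^^ m) b)) = poly (partial_bracket a ((\<delta> ^^ m) b)) t - \<theta>' (\<delta> a) * brF (\<theta> ((\<delta> ^^ m) b)) t" for m
    using bracket_\<theta>'_left[OF a, of "\<theta> ((\<delta> ^^ m) b)"] skew[of t "\<theta> ((\<delta> ^^ m) b)"] by (simp add: partial_bracket_def)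
  have "poly (q (\<lambda>m. brF (\<theta>' a) (\<theta> ((\<delta> ^^ m) b)))) t = poly W t - \<theta>' (\<delta> a) * poly V t"
    by (simp add: br_left q_def W_def V_def poly_sum poly_monom sum_distrib_left sum_subtractf
        diff_divide_distrib right_diff_distrib mult.assoc mult.commute mult.left_commute)
  then have "brF (\<theta>' a) (\<theta>' b) = poly W t - \<theta>' (\<delta> a) * (t * \<theta>' (\<alpha> b)) + \<theta>' (\<delta> b) * (t * \<theta>' (\<alpha> a))"
    unfolding \<theta>'_def[of b] poly_right map V pderiv_expansion[OF b]
    using bracket_\<theta>'_t[OF a] V by (simp add: \<theta>'_def)
  also have "poly W t = \<theta>' (br a b) - t * \<theta>' (twist a b)"
    by (simp add: W \<theta>'_def)
  also have "\<theta>' (twist a b) = \<theta>' (\<alpha> a) * \<theta>' (\<delta> b) - \<theta>' (\<delta> a) * \<theta>' (\<alpha> b)"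
    using a b by (simp add: twist_def \<theta>'_diff \<theta>'_mult B_\<alpha> B_\<delta> B_mult)
  finally show ?thesis by (simp add: algebra_simps)
qed

text \<open>The bracket of \<open>w\<close> with \<open>t\<close> has coefficient
  \<open>- \<theta> \<kappa>\<close>, which cancels the Euler term from
  \<open>intertwine_pow\<close>. This preserves the relations with the variables whose derivations
  are already deleted.\<close>

lemma bracket_intertwine_\<theta>':
  assumes \<beta>: "\<And>b. b \<in> B \<Longrightarrow> \<beta> b \<in> B" "\<And>b. b \<in> B \<Longrightarrow> \<beta> (\<delta> b) = \<delta> (\<beta> b) + \<kappa> * \<delta> b"
    and \<kappa>: "\<kappa> \<in> B" "\<And>b. b \<in> B \<Longrightarrow> \<delta> (\<kappa> * b) = \<kappa> * \<delta> b"
    and w: "\<And>b. b \<in> B \<Longrightarrow> brF w (\<theta> b) = \<theta> (\<beta> b) * w" and wz: "brF w z = \<theta> \<kappa> * z * w"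
    and b: "b \<in> B"
  shows "brF w (\<theta>' b) = \<theta>' (\<beta> b) * w"
proof -
  have wt: "brF w t = - \<theta> \<kappa> * t * w"
  proof (cases "z = 0")
    case False
    then have nz: "\<theta> s * z \<noteq> 0" using \<theta>_s(2) by simp
    have br: "brF w (\<theta> s * z) = \<theta> s * (\<theta> \<kappa> * z * w)" using \<theta>_s(1) by (simp add: central_mult_right wz)
    show ?thesis
      using False \<theta>_s(2) unfolding t_def divide_right[OF nz] br minus_right one_right
      by (simp add: field_simps)
  next
    case True
    then have "t = 0" unfolding t_def by simp
    then show ?thesis by simp
  qed
  have "map_poly (brF w) (expansion b) =
      smult w (expansion (\<beta> b) + pCons 0 (smult (\<theta> \<kappa>) (expansion (\<delta> b))))"
  proof (rule poly_eqI)
    fix l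
    have "\<theta> (of_nat l * (\<kappa> * (\<delta> ^^ l) b)) = of_nat l * (\<theta> \<kappa> * \<theta> ((\<delta> ^^ l) b))"
        "of_nat l * (\<kappa> * (\<delta> ^^ l) b) \<in> B"
      using b \<kappa>(1) \<theta>_of_nat_mult[of "\<kappa> * (\<delta> ^^ l) b" l] by (simp_all add: \<theta>_mult B_mult B_pow)
    then have "brF w (\<theta> ((\<delta> ^^ l) b)) = (\<theta> ((\<delta> ^^ l) (\<beta> b)) + of_nat l * (\<theta> \<kappa> * \<theta> ((\<delta> ^^ l) b))) * w"
      using b w[OF B_pow[OF b]] intertwine_pow[of \<beta> \<kappa>, OF \<beta> \<kappa> b] by (simp add: \<theta>_add B_pow \<beta>(1))
    then show "coeff (map_poly (brF w) (expansion b)) l =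
        coeff (smult w (expansion (\<beta> b) + pCons 0 (smult (\<theta> \<kappa>) (expansion (\<delta> b))))) l"
      using b \<beta>(1) by (simp add: coeff_map_poly coeff_expansion divide_of_nat_right coeff_shift_expansion
          add_divide_distrib algebra_simps)
  qed
  then show ?thesis
    unfolding \<theta>'_def poly_right pderiv_expansion[OF b] wt by (simp add: algebra_simps)
qed

lemma \<theta>'_eq_sum:
  assumes b: "b \<in> B" and N: "(\<delta> ^^ N) b = 0"
  shows "\<theta>' b = (\<Sum>l<N. \<theta> ((\<delta> ^^ l) b) / of_nat (fact l) * t ^ l)"
proof -
  have "expansion b = (\<Sum>l<N. monom (\<theta> ((\<delta> ^^ l) b) / of_nat (fact l)) l)"
    using b pow_eq_0_mono[of N _ b] N
    by (intro poly_eqI) (auto simp: coeff_sum coeff_expansion if_distrib sum.delta' cong: if_cong)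
  then show ?thesis by (simp add: \<theta>'_def poly_sum poly_monom)
qed

text \<open>Clearing the denominators in \<open>t\<close> leaves a polynomial in \<open>z\<close>
  over the image of \<open>B\<close> whose top coefficient, at \<open>l = 0\<close>, is
  \<open>\<theta> b\<close>. The proof of algebraic independence rests on this.\<close>

lemma power_mult_\<theta>':
  assumes b: "b \<in> B" and N: "(\<delta> ^^ N) b = 0" and z0: "z \<noteq> 0"
  shows "z ^ N * \<theta>' b = (\<Sum>l<N. (- 1 / \<theta> s) ^ l / of_nat (fact l) * (\<theta> ((\<delta> ^^ l) b) * z ^ (N - l)))"
proof -
  have "z ^ N * (c * t ^ l) = (- 1 / \<theta> s) ^ l * (c * z ^ (N - l))" if "l < N" for c l
  proof -
    have "z ^ N = z ^ (N - l) * z ^ l" using that by (simp flip: power_add)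
    moreover have "z ^ l * t ^ l = (- 1 / \<theta> s) ^ l"
      using z0 by (simp add: t_def flip: power_mult_distrib)
    moreover have "z ^ (N - l) * z ^ l * (c * t ^ l) = z ^ l * t ^ l * (c * z ^ (N - l))"
      by (simp only: mult_ac)
    ultimately show ?thesis by simp
  qed
  then show ?thesis
    unfolding \<theta>'_eq_sum[OF b N] sum_distrib_left by (intro sum.cong) simp_all
qed

text \<open>The difference of \<open>\<theta>' b\<close> and \<open>\<theta> b\<close> involves only
  proper iterates of \<delta>, which have smaller nilpotency index. Induction on that index
  therefore recovers \<theta> from \<open>\<theta>'\<close>.\<close>

lemma \<theta>_mem_subfield:
  assumes L: "subfield_set L" and "z \<in> L" "\<theta> s \<in> L" and sub: "\<And>b. b \<in> B \<Longrightarrow> \<theta>' b \<in> L"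
    and "b \<in> B"
  shows "\<theta> b \<in> L"
proof -
  have t: "t \<in> L"
    unfolding t_def using assms by (intro subfield_set_divide) (auto intro: subfield_setD)
  obtain N where "(\<delta> ^^ N) b = 0" using nilpotent assms by blast
  then show ?thesis using \<open>b \<in> B\<close>
  proof (induction N arbitrary: b)
    case 0
    then show ?case using L by (simp add: subfield_setD)
  next
    case (Suc N)
    let ?r = "\<Sum>l<N. \<theta> ((\<delta> ^^ Suc l) b) / of_nat (fact (Suc l)) * t ^ Suc l"
    have "\<theta>' b = \<theta> b + ?r"
      unfolding \<theta>'_eq_sum[OF Suc.prems(2,1)] by (subst sum.lessThan_Suc_shift) simp
    moreover have "?r \<in> L"
    proof (intro subfield_set_sum[OF L] subfield_setD(4)[OF L] subfield_set_divide[OF L]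
        subfield_set_of_nat[OF L] subfield_set_power[OF L] t)
      fix l
      have "(\<delta> ^^ N) ((\<delta> ^^ Suc l) b) = (\<delta> ^^ l) ((\<delta> ^^ Suc N) b)"
        by (metis add.commute add_Suc_shift comp_apply funpow_add)
      then show "\<theta> ((\<delta> ^^ Suc l) b) \<in> L"
        using Suc.prems by (intro Suc.IH) auto
    qed
    ultimately have "\<theta> b = \<theta>' b - ?r" by simp
    then show ?case using \<open>?r \<in> L\<close> sub[OF Suc.prems(2)] by (auto intro: subfield_setD(6)[OF L])
  qed
qed

end

section \<open>Deleting all derivations\<close>

text \<open>The data of the theorem with a map \<open>h\<close> to the field. The conditions on
  \<alpha> and \<delta> include index 0, so that one step handles every variable. The zero ideal
  enters later as \<open>inj h\<close>.\<close>

locale poisson_quotient = poisson_field brF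
  for brF :: "'b::field \<Rightarrow> 'b \<Rightarrow> 'b" +
  fixes k :: "'a::{comm_ring_1, ring_char_0} set"
    and br :: "'a \<Rightarrow> 'a \<Rightarrow> 'a"
    and x :: "nat \<Rightarrow> 'a"
    and n :: nat
    and \<alpha> \<delta> :: "nat \<Rightarrow> 'a \<Rightarrow> 'a"
    and lam :: "nat \<Rightarrow> nat \<Rightarrow> 'a"
    and s :: "nat \<Rightarrow> 'a"
    and h :: "'a \<Rightarrow> 'b"
  assumes k: "subfield_set k"
    and indep: "alg_indep k x n"
    and span: "poly_span k x n = UNIV"
    and br_poisson: "poisson_bracket br"
    and br_linear: "k_linear_bracket k br"
    and \<alpha>: "i < n \<Longrightarrow> poisson_derivation_on k br (poly_span k x i) (\<alpha> i)"
    and \<delta>: "i < n \<Longrightarrow> derivation_on k (poly_span k x i) (\<delta> i)"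
    and \<delta>_skew: "i < n \<Longrightarrow> skew_poisson_condition br (poly_span k x i) (\<alpha> i) (\<delta> i)"
    and br_x: "i < n \<Longrightarrow> b \<in> poly_span k x i \<Longrightarrow> br (x i) b = \<alpha> i b * x i + \<delta> i b"
    and nilpotent: "i < n \<Longrightarrow> b \<in> poly_span k x i \<Longrightarrow> \<exists>N. (\<delta> i ^^ N) b = 0"
    and s: "i < n \<Longrightarrow> s i \<in> k" "i < n \<Longrightarrow> s i \<noteq> 0"
    and \<alpha>_\<delta>: "i < n \<Longrightarrow> b \<in> poly_span k x i \<Longrightarrow> \<alpha> i (\<delta> i b) = \<delta> i (\<alpha> i b + s i * b)"
    and lam: "j < i \<Longrightarrow> i < n \<Longrightarrow> lam i j \<in> k"
    and \<alpha>_x: "j < i \<Longrightarrow> i < n \<Longrightarrow> \<alpha> i (x j) = lam i j * x j"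
    and h_add: "h (a + b) = h a + h b"
    and h_mult: "h (a * b) = h a * h b"
    and h_1 [simp]: "h 1 = 1"
    and h_br: "h (br a b) = brF (h a) (h b)"
    and h_fraction: "\<exists>a b. h b \<noteq> 0 \<and> w = h a / h b"
begin

section \<open>The tower of subalgebras\<close>

abbreviation A :: "nat \<Rightarrow> 'a set" where
  "A i \<equiv> poly_span k x i"

lemmas A_intros =
  poly_span_add[OF k] poly_span_mult[OF k] poly_span_minus[OF k] poly_span_diff[OF k]
  poly_span_power[OF k]

lemma br_add_left: "br (a + b) c = br a c + br b c"
  and br_skew: "br a b = - br b a"
  and br_mult_right: "br a (b * c) = br a b * c + b * br a c"
  using br_poisson unfolding poisson_bracket_def by blast+

lemma br_add_right: "br a (b + c) = br a b + br a c"
  using br_skew[of a "b + c"] br_skew[of a b] br_skew[of a c] by (simp add: br_add_left)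

lemma br_mult_left: "br (b * c) a = br b a * c + b * br c a"
  using br_skew[of "b * c" a] br_skew[of b a] br_skew[of c a] br_mult_right[of a b c] by simp

lemma br_const_left: "c \<in> k \<Longrightarrow> br c a = 0"
proof -
  assume c: "c \<in> k"
  have "br 1 a = 0" using br_mult_left[of 1 1 a] by simp
  then show ?thesis using br_linear c unfolding k_linear_bracket_def by (metis mult.right_neutral mult_zero_right)
qed

lemma br_const_right: "c \<in> k \<Longrightarrow> br a c = 0"
  using br_const_left[of c a] br_skew[of a c] by simp

text \<open>Skew-symmetry only gives that twice the bracket is zero; 2 is then inverted inside the
  subfield \<open>k\<close>.\<close>

lemma br_self: "br a a = 0"
proof -
  have "of_nat 2 \<in> k" "of_nat 2 \<noteq> (0::'a)" using subfield_set_of_nat[OF k, of 2] by auto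
  then obtain c where c: "of_nat 2 * c = (1::'a)" using k unfolding subfield_set_def by blast
  have "of_nat 2 * br a a = 0" using br_skew[of a a] by (metis eq_neg_iff_add_eq_0 mult_2 of_nat_numeral)
  then have "(of_nat 2 * c) * br a a = 0" by (metis mult.assoc mult.commute mult_zero_right)
  then show ?thesis using c by simp
qed

lemma \<alpha>_mem: "i < n \<Longrightarrow> b \<in> A i \<Longrightarrow> \<alpha> i b \<in> A i"
  and \<alpha>_add: "i < n \<Longrightarrow> a \<in> A i \<Longrightarrow> b \<in> A i \<Longrightarrow> \<alpha> i (a + b) = \<alpha> i a + \<alpha> i b"
  and \<alpha>_mult: "i < n \<Longrightarrow> a \<in> A i \<Longrightarrow> b \<in> A i \<Longrightarrow> \<alpha> i (a * b) = \<alpha> i a * b + a * \<alpha> i b"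
  and \<alpha>_scale: "i < n \<Longrightarrow> c \<in> k \<Longrightarrow> b \<in> A i \<Longrightarrow> \<alpha> i (c * b) = c * \<alpha> i b"
  and \<alpha>_br: "i < n \<Longrightarrow> a \<in> A i \<Longrightarrow> b \<in> A i \<Longrightarrow> \<alpha> i (br a b) = br (\<alpha> i a) b + br a (\<alpha> i b)"
  using \<alpha>[of i] unfolding poisson_derivation_on_def derivation_on_def by blast+

lemma \<delta>_mem: "i < n \<Longrightarrow> b \<in> A i \<Longrightarrow> \<delta> i b \<in> A i"
  and \<delta>_add: "i < n \<Longrightarrow> a \<in> A i \<Longrightarrow> b \<in> A i \<Longrightarrow> \<delta> i (a + b) = \<delta> i a + \<delta> i b"
  and \<delta>_mult: "i < n \<Longrightarrow> a \<in> A i \<Longrightarrow> b \<in> A i \<Longrightarrow> \<delta> i (a * b) = \<delta> i a * b + a * \<delta> i b"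
  and \<delta>_scale: "i < n \<Longrightarrow> c \<in> k \<Longrightarrow> b \<in> A i \<Longrightarrow> \<delta> i (c * b) = c * \<delta> i b"
  using \<delta>[of i] unfolding derivation_on_def by blast+

lemma one_mem: "1 \<in> A i"
  by (rule poly_span_const) (rule subfield_setD(2)[OF k])

lemma \<alpha>_const: "i < n \<Longrightarrow> c \<in> k \<Longrightarrow> \<alpha> i c = 0"
  using \<alpha>_scale[of i c 1] \<alpha>_mult[of i 1 1] one_mem by simp

lemma \<delta>_const: "i < n \<Longrightarrow> c \<in> k \<Longrightarrow> \<delta> i c = 0"
  using \<delta>_scale[of i c 1] \<delta>_mult[of i 1 1] one_mem by simp

lemma x_mem: "j < i \<Longrightarrow> x j \<in> A i"
  by (rule poly_span_var[OF k])

lemma A_mono: "i \<le> j \<Longrightarrow> b \<in> A i \<Longrightarrow> b \<in> A j"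
  using poly_span_mono[of i j k x] by blast

text \<open>\<open>br_x\<close> controls the newest variable against earlier elements only, so
  closure is built in three passes: \<open>x i\<close> against everything, earlier elements against
  everything, and finally everything against everything.\<close>

lemma br_mem: "i \<le> n \<Longrightarrow> a \<in> A i \<Longrightarrow> b \<in> A i \<Longrightarrow> br a b \<in> A i"
proof (induction i arbitrary: a b)
  case 0
  then show ?case by (simp add: poly_span_0[OF k] br_const_left subfield_setD[OF k])
next
  case (Suc i)
  have mono: "b \<in> A (Suc i)" if "b \<in> A i" for b using A_mono[of i "Suc i" b] that by simp
  have x_br: "br (x i) b \<in> A (Suc i)" if "b \<in> A i" for b
    using that Suc.prems
    by (simp add: br_x A_intros x_mem mono \<alpha>_mem \<delta>_mem)
  have 1: "A (Suc i) \<subseteq> {b \<in> A (Suc i). br (x i) b \<in> A (Suc i)}"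
    by (rule poly_span_Suc_subset[OF k])
      (auto simp: br_add_right br_mult_right br_self x_br x_mem intro: A_intros mono poly_span_const subfield_setD[OF k])
  have 2: "A (Suc i) \<subseteq> {b \<in> A (Suc i). br a b \<in> A (Suc i)}" if "a \<in> A i" for a
    using that Suc.prems Suc.IH[of a] x_br[of a] br_skew[of a "x i"]
    by (intro poly_span_Suc_subset[OF k])
      (auto simp: br_add_right br_mult_right x_mem intro: A_intros mono)
  have "A (Suc i) \<subseteq> {a \<in> A (Suc i). \<forall>b \<in> A (Suc i). br a b \<in> A (Suc i)}"
    using 1 2
    by (intro poly_span_Suc_subset[OF k])
      (auto simp: br_add_left br_mult_left x_mem intro!: A_intros intro: mono)
  then show ?case using Suc.prems by blast
qed

text \<open>\<open>\<alpha> j\<close> scales each variable, so it preserves all the smaller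
  subalgebras too.\<close>

lemma \<alpha>_mem_below: "i \<le> j \<Longrightarrow> j < n \<Longrightarrow> b \<in> A i \<Longrightarrow> \<alpha> j b \<in> A i"
proof -
  assume ij: "i \<le> j" "j < n" and "b \<in> A i"
  show ?thesis using k \<open>b \<in> A i\<close>
  proof (induction rule: poly_span_induct)
    case (var l)
    then have "lam j l \<in> A i" using ij lam[of l j] by (simp add: poly_span_const)
    then show ?case using var ij by (auto simp: \<alpha>_x intro!: A_intros x_mem)
  next
    case (const c)
    then show ?case using ij by (simp add: \<alpha>_const poly_span_const subfield_setD[OF k])
  qed (use ij A_mono[of i j] in \<open>auto simp: \<alpha>_add \<alpha>_mult intro!: A_intros\<close>)
qed

text \<open>Both derivations are diagonal on the variables.\<close>

lemma \<alpha>_commute: "i < j \<Longrightarrow> j < n \<Longrightarrow> b \<in> A i \<Longrightarrow> \<alpha> j (\<alpha> i b) = \<alpha> i (\<alpha> j b)"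
proof -
  assume ij: "i < j" "j < n" and "b \<in> A i"
  have mono: "b \<in> A j" if "b \<in> A i" for b using A_mono[of i j b] ij that by simp
  note mem = mono \<alpha>_mem_below[of i i] \<alpha>_mem_below[of i j]
  show ?thesis using k \<open>b \<in> A i\<close>
  proof (induction rule: poly_span_induct)
    case (const c)
    then show ?case using ij by (simp add: \<alpha>_const subfield_setD[OF k])
  next
    case (var l)
    then show ?case using ij by (simp add: \<alpha>_x \<alpha>_scale lam x_mem)
  next
    case (add a b)
    then show ?case using ij by (simp add: \<alpha>_add mem)
  next
    case (mult a b)
    then show ?case using ij by (simp add: \<alpha>_add \<alpha>_mult mem A_intros algebra_simps)
  qed
qed

text \<open>Apply \<open>\<alpha> j\<close> to \<open>br (x i) b\<close> as a Poisson derivation and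
  expand with \<open>br_x\<close>; the terms containing \<open>x i\<close> cancel by
  \<open>\<alpha>_commute\<close>. This is the intertwining relation with \<kappa> equal to
  \<open>lam j i\<close>.\<close>

lemma \<alpha>_\<delta>_commute:
  assumes ij: "i < j" "j < n" and b: "b \<in> A i"
  shows "\<alpha> j (\<delta> i b) = \<delta> i (\<alpha> j b) + lam j i * \<delta> i b"
proof -
  have mono: "c \<in> A j" if "c \<in> A i" for c using A_mono[of i j c] ij that by simp
  have "\<alpha> j (br (x i) b) = br (\<alpha> j (x i)) b + br (x i) (\<alpha> j b)"
    using ij b by (intro \<alpha>_br) (auto intro: x_mem mono)
  moreover have "br (\<alpha> j (x i)) b = lam j i * (\<alpha> i b * x i + \<delta> i b)"
    using ij b by (simp add: \<alpha>_x br_mult_left br_const_left lam br_x)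
  moreover have "br (x i) (\<alpha> j b) = \<alpha> j (\<alpha> i b) * x i + \<delta> i (\<alpha> j b)"
    using ij b by (simp add: br_x \<alpha>_mem_below \<alpha>_commute)
  moreover have "\<alpha> j (br (x i) b) = \<alpha> j (\<alpha> i b) * x i + \<alpha> i b * (lam j i * x i) + \<alpha> j (\<delta> i b)"
    using ij b by (simp add: br_x \<alpha>_add \<alpha>_mult \<alpha>_x mono \<alpha>_mem \<delta>_mem x_mem A_intros)
  ultimately show ?thesis by (simp add: algebra_simps)
qed

lemma h_0 [simp]: "h 0 = 0"
  by (metis h_add add_0_right add_cancel_left_right)

lemma h_minus: "h (- a) = - h a"
  using h_add[of a "- a"] by (simp add: eq_neg_iff_add_eq_0 add.commute)

lemma h_of_nat: "h (of_nat m) = of_nat m"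
  by (induction m) (auto simp: h_add)

lemma h_nonzero: "c \<in> k \<Longrightarrow> c \<noteq> 0 \<Longrightarrow> h c \<noteq> 0"
  using k unfolding subfield_set_def by (metis h_1 h_mult mult_zero_left zero_neq_one)

text \<open>Constants bracket to zero in the algebra, and the quotient rule extends this from the
  image of \<open>h\<close> to all fractions.\<close>

lemma h_const_center: "c \<in> k \<Longrightarrow> h c \<in> center"
proof -
  assume c: "c \<in> k"
  have "brF (h a) (h c) = 0" for a using h_br[of a c] c by (simp add: br_const_right)
  then have *: "brF (h c) (h a) = 0" for a using skew[of "h c" "h a"] by simp
  have "brF (h c) w = 0" for w
    using h_fraction[of w] * by (auto simp: divide_right)
  then show ?thesis using skew[of _ "h c"] unfolding center_def by simp
qed

lemma subfield_set_h: "subfield_set (h ` k)"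
proof -
  have "\<exists>b\<in>k. h c * h b = 1" if "c \<in> k" "h c \<noteq> 0" for c
    using that k h_0 unfolding subfield_set_def by (metis h_1 h_mult)
  then show ?thesis
    unfolding subfield_set_def
    by (auto simp flip: h_add h_mult h_1 h_0 h_minus intro!: imageI subfield_setD[OF k])
qed

end

section \<open>Descent through the stages\<close>

context poisson_quotient
begin

text \<open>In \<open>stage i\<close> the derivations \<open>\<delta> i, \<dots>, \<delta> (n - 1)\<close> have been deleted: \<open>\<theta>\<close> is defined on
  \<open>A\<^sub>i\<close> only, and \<open>x\<^sub>j\<close> has become \<open>y j\<close> for \<open>j \<ge> i\<close>.\<close>
definition stage :: "nat \<Rightarrow> ('a \<Rightarrow> 'b) \<Rightarrow> (nat \<Rightarrow> 'b) \<Rightarrow> bool" where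
  "stage i \<theta> y \<longleftrightarrow>
    (\<forall>a\<in>A i. \<forall>b\<in>A i. \<theta> (a + b) = \<theta> a + \<theta> b \<and> \<theta> (a * b) = \<theta> a * \<theta> b \<and> \<theta> (br a b) = brF (\<theta> a) (\<theta> b)) \<and>
    (\<forall>c\<in>k. \<theta> c = h c) \<and>
    (\<forall>j b. i \<le> j \<and> j < n \<and> b \<in> A i \<longrightarrow> brF (y j) (\<theta> b) = \<theta> (\<alpha> j b) * y j) \<and>
    (\<forall>j l. i \<le> l \<and> l < j \<and> j < n \<longrightarrow> brF (y j) (y l) = h (lam j l) * y j * y l) \<and>
    (\<forall>L. subfield_set L \<and> \<theta> ` A i \<subseteq> L \<and> y ` {i..<n} \<subseteq> L \<longrightarrow> L = UNIV)"

text \<open>Coefficients are taken before applying \<theta>, so the empty monomial alone already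
  says that \<theta> has zero kernel on \<open>A i\<close>. At \<open>i = 0\<close> this becomes
  algebraic independence over the image of \<open>k\<close>.\<close>

definition independent_stage :: "nat \<Rightarrow> ('a \<Rightarrow> 'b) \<Rightarrow> (nat \<Rightarrow> 'b) \<Rightarrow> bool" where
  "independent_stage i \<theta> y \<longleftrightarrow>
    (\<forall>S b. finite S \<and> (\<forall>M\<in>S. set_mset M \<subseteq> {i..<n} \<and> b M \<in> A i) \<and> (\<Sum>M\<in>S. \<theta> (b M) * mono y M) = 0
      \<longrightarrow> (\<forall>M\<in>S. b M = 0))"

lemma stageD:
  assumes "stage i \<theta> y"
  shows "a \<in> A i \<Longrightarrow> b \<in> A i \<Longrightarrow> \<theta> (a + b) = \<theta> a + \<theta> b"
    and "a \<in> A i \<Longrightarrow> b \<in> A i \<Longrightarrow> \<theta> (a * b) = \<theta> a * \<theta> b"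
    and "a \<in> A i \<Longrightarrow> b \<in> A i \<Longrightarrow> \<theta> (br a b) = brF (\<theta> a) (\<theta> b)"
    and "c \<in> k \<Longrightarrow> \<theta> c = h c"
    and "i \<le> j \<Longrightarrow> j < n \<Longrightarrow> b \<in> A i \<Longrightarrow> brF (y j) (\<theta> b) = \<theta> (\<alpha> j b) * y j"
    and "i \<le> l \<Longrightarrow> l < j \<Longrightarrow> j < n \<Longrightarrow> brF (y j) (y l) = h (lam j l) * y j * y l"
    and "subfield_set L \<Longrightarrow> \<theta> ` A i \<subseteq> L \<Longrightarrow> y ` {i..<n} \<subseteq> L \<Longrightarrow> L = UNIV"
proof -
  note * = assms[unfolded stage_def]
  note ** = *[THEN conjunct2, THEN conjunct2, THEN conjunct2]
  show "a \<in> A i \<Longrightarrow> b \<in> A i \<Longrightarrow> \<theta> (a + b) = \<theta> a + \<theta> b"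
    and "a \<in> A i \<Longrightarrow> b \<in> A i \<Longrightarrow> \<theta> (a * b) = \<theta> a * \<theta> b"
    and "a \<in> A i \<Longrightarrow> b \<in> A i \<Longrightarrow> \<theta> (br a b) = brF (\<theta> a) (\<theta> b)"
    using *[THEN conjunct1] by simp_all
  show "c \<in> k \<Longrightarrow> \<theta> c = h c"
    using *[THEN conjunct2, THEN conjunct1] by simp
  show "i \<le> j \<Longrightarrow> j < n \<Longrightarrow> b \<in> A i \<Longrightarrow> brF (y j) (\<theta> b) = \<theta> (\<alpha> j b) * y j"
    using *[THEN conjunct2, THEN conjunct2, THEN conjunct1] by simp
  show "i \<le> l \<Longrightarrow> l < j \<Longrightarrow> j < n \<Longrightarrow> brF (y j) (y l) = h (lam j l) * y j * y l"
    using **[THEN conjunct1] by simp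
  show "subfield_set L \<Longrightarrow> \<theta> ` A i \<subseteq> L \<Longrightarrow> y ` {i..<n} \<subseteq> L \<Longrightarrow> L = UNIV"
    by (rule **[THEN conjunct2, rule_format]) (intro conjI)
qed

lemma independent_stageD:
  assumes "independent_stage i \<theta> y" "finite S" "\<And>M. M \<in> S \<Longrightarrow> set_mset M \<subseteq> {i..<n}"
    "\<And>M. M \<in> S \<Longrightarrow> b M \<in> A i" "(\<Sum>M\<in>S. \<theta> (b M) * mono y M) = 0" "M \<in> S"
  shows "b M = 0"
  using assms unfolding independent_stage_def by blast

lemma x_nonzero: "i < n \<Longrightarrow> x i \<noteq> 0"
  \<comment> \<open>With \<open>a = of_nat\<close> the polynomial has coefficients 0 and 1, so it is
    \<open>x i\<close> itself.\<close>
  using alg_indep_power_sum_eq_0[OF indep, where i = i and N = 2 and a = of_nat and e = 1]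
    poly_span_const[OF subfield_set_of_nat[OF k]]
  by (auto simp: numeral_2_eq_2)

lemma stage_top: "stage n h y"
  unfolding stage_def
proof (intro conjI allI impI ballI)
  fix L assume L: "subfield_set L \<and> h ` A n \<subseteq> L \<and> y ` {n..<n} \<subseteq> L"
  then have "h a \<in> L" for a using span by auto
  then have quot: "h a / h b \<in> L" for a b using L by (intro subfield_set_divide) auto
  have "w \<in> L" for w
  proof -
    obtain a b where "w = h a / h b" using h_fraction[of w] by blast
    then show ?thesis using quot by simp
  qed
  then show "L = UNIV" by auto
qed (auto simp: h_add h_mult h_br)

lemma independent_stage_top:
  assumes "inj h"
  shows "independent_stage n h y"
  unfolding independent_stage_def
proof (intro allI impI ballI)
  fix S b M
  assume S: "finite S \<and> (\<forall>M\<in>S. set_mset M \<subseteq> {n..<n} \<and> b M \<in> A n) \<and> (\<Sum>M\<in>S. h (b M) * mono y M) = 0"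
    and M: "M \<in> S"
  have "N = {#}" if "N \<in> S" for N using S that by simp
  then have "S = {{#}}" "M = {#}" using M by auto
  then have "h (b M) = 0" using S by simp
  then show "b M = 0" using injD[OF assms, of "b M" 0] by simp
qed

lemma deleting_derivation_stage:
  assumes i: "i < n" and st: "stage (Suc i) \<theta> y"
  shows "deleting_derivation brF (A i) br (\<alpha> i) (\<delta> i) \<theta> (\<theta> (x i)) (s i)"
proof -
  have mono: "b \<in> A (Suc i)" if "b \<in> A i" for b using A_mono[of i "Suc i" b] that by simp
  have Sm: "s i \<in> A i" using s[OF i] by (auto intro: poly_span_const)
  show ?thesis
  proof
    fix a b
    show "br (a + b) c = br a c + br b c" for c by (rule br_add_left)
    show "br a (b + c) = br a b + br a c" for c by (rule br_add_right)
    show "0 \<in> A i" by (intro poly_span_const subfield_setD[OF k])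
    show "s i \<in> A i" by (rule Sm)
    show "\<theta> (s i) \<in> center" "\<theta> (s i) \<noteq> 0"
      using s[OF i] by (auto simp: stageD(4)[OF st] h_const_center h_nonzero)
    assume a: "a \<in> A i"
    show "\<alpha> i a \<in> A i" "\<delta> i a \<in> A i" using i a by (auto intro: \<alpha>_mem \<delta>_mem)
    show "\<exists>N. (\<delta> i ^^ N) a = 0" using nilpotent i a by blast
    show "\<delta> i (s i * a) = s i * \<delta> i a" using i a s by (intro \<delta>_scale) auto
    show "\<alpha> i (\<delta> i a) = \<delta> i (\<alpha> i a) + s i * \<delta> i a"
      using i a s by (simp add: \<alpha>_\<delta> \<delta>_add \<delta>_scale \<alpha>_mem A_intros poly_span_const)
    have "brF (\<theta> (x i)) (\<theta> a) = \<theta> (br (x i) a)"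
      using a mono by (simp add: stageD(3)[OF st] x_mem)
    also have "\<dots> = \<theta> (\<alpha> i a) * \<theta> (x i) + \<theta> (\<delta> i a)"
      using i a mono by (simp add: br_x stageD[OF st] A_intros x_mem \<alpha>_mem \<delta>_mem)
    finally show "brF (\<theta> (x i)) (\<theta> a) = \<theta> (\<alpha> i a) * \<theta> (x i) + \<theta> (\<delta> i a)" .
    assume b: "b \<in> A i"
    show "a + b \<in> A i" "a - b \<in> A i" "a * b \<in> A i" using a b by (auto intro: A_intros)
    show "br a b \<in> A i" using i a b by (intro br_mem) auto
    show "\<delta> i (a + b) = \<delta> i a + \<delta> i b" "\<delta> i (a * b) = \<delta> i a * b + a * \<delta> i b"
      using i a b by (auto simp: \<delta>_add \<delta>_mult)
    show "\<delta> i (br a b) = br (\<delta> i a) b + br a (\<delta> i b) + (\<alpha> i a * \<delta> i b - \<delta> i a * \<alpha> i b)"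
      using \<delta>_skew[OF i] a b unfolding skew_poisson_condition_def by simp
    show "\<theta> (a + b) = \<theta> a + \<theta> b" "\<theta> (a * b) = \<theta> a * \<theta> b" "\<theta> (br a b) = brF (\<theta> a) (\<theta> b)"
      using a b mono by (auto simp: stageD[OF st])
  qed
qed

text \<open>The generator \<open>y i\<close> is the value of \<open>x i\<close> before this
  deletion. Its brackets with later generators come from the old stage applied to
  \<open>x i\<close>, and generation survives because \<open>\<theta>_mem_subfield\<close> recovers
  the old map.\<close>

lemma stage_step:
  fixes \<theta> :: "'a \<Rightarrow> 'b"
  assumes i: "i < n" and st: "stage (Suc i) \<theta> y"
  defines "\<theta>' \<equiv> deleting_derivation.\<theta>' (\<delta> i) \<theta> (\<theta> (x i)) (s i)"
  shows "stage i \<theta>' (y(i := \<theta> (x i)))"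
proof -
  interpret d: deleting_derivation brF "A i" br "\<alpha> i" "\<delta> i" \<theta> "\<theta> (x i)" "s i"
    by (rule deleting_derivation_stage[OF i st])
  have \<theta>': "\<theta>' = d.\<theta>'" by (simp add: \<theta>'_def)
  have mono: "b \<in> A (Suc i)" if "b \<in> A i" for b using A_mono[of i "Suc i" b] that by simp
  have const: "\<theta>' c = h c" if "c \<in> k" for c
    using that i unfolding \<theta>' by (subst d.\<theta>'_if_\<delta>_0) (auto simp: \<delta>_const stageD(4)[OF st] intro: poly_span_const)
  have bracket_x: "brF (y j) (\<theta> (x i)) = h (lam j i) * \<theta> (x i) * y j" if "i < j" "j < n" for j
  proof -
    have "lam j i \<in> A (Suc i)" "x i \<in> A (Suc i)" using lam that by (auto intro: poly_span_const x_mem)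
    then show ?thesis
      using that stageD(5)[OF st, of j "x i"] lam by (simp add: \<alpha>_x stageD(2)[OF st] stageD(4)[OF st])
  qed
  show ?thesis
    unfolding stage_def
  proof (intro conjI ballI allI impI)
    fix a b assume "a \<in> A i" "b \<in> A i"
    then show "\<theta>' (a + b) = \<theta>' a + \<theta>' b" "\<theta>' (a * b) = \<theta>' a * \<theta>' b"
      "\<theta>' (br a b) = brF (\<theta>' a) (\<theta>' b)"
      by (auto simp: \<theta>' d.\<theta>'_add d.\<theta>'_mult d.bracket_\<theta>')
  next
    fix j b assume *: "i \<le> j \<and> j < n \<and> b \<in> A i"
    show "brF ((y(i := \<theta> (x i))) j) (\<theta>' b) = \<theta>' (\<alpha> j b) * (y(i := \<theta> (x i))) j"
    proof (cases "j = i")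
      case True
      then show ?thesis using * by (simp add: \<theta>' d.bracket_z_\<theta>')
    next
      case False
      then have j: "i < j" "j < n" using * by auto
      have "brF (y j) (d.\<theta>' b) = d.\<theta>' (\<alpha> j b) * y j"
      \<comment> \<open>\<open>\<alpha>_\<delta>_commute\<close> supplies the intertwining
        hypothesis for this \<kappa>.\<close>
      proof (rule d.bracket_intertwine_\<theta>'[where \<kappa> = "lam j i"])
        show "brF (y j) (\<theta> (x i)) = \<theta> (lam j i) * \<theta> (x i) * y j"
          using j by (simp add: bracket_x stageD(4)[OF st] lam)
        show "brF (y j) (\<theta> b) = \<theta> (\<alpha> j b) * y j" if "b \<in> A i" for b
          using j that mono by (simp add: stageD(5)[OF st])
      qed (use j * in \<open>auto simp: \<alpha>_\<delta>_commute \<delta>_scale lam intro: \<alpha>_mem_below poly_span_const\<close>)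
      then show ?thesis using False by (simp add: \<theta>')
    qed
  next
    fix j l assume *: "i \<le> l \<and> l < j \<and> j < n"
    show "brF ((y(i := \<theta> (x i))) j) ((y(i := \<theta> (x i))) l) = h (lam j l) * (y(i := \<theta> (x i))) j * (y(i := \<theta> (x i))) l"
    proof (cases "l = i")
      case True
      then show ?thesis using * by (simp add: bracket_x)
    next
      case False
      then show ?thesis using * by (simp add: stageD(6)[OF st])
    qed
  next
    fix L assume "subfield_set L \<and> \<theta>' ` A i \<subseteq> L \<and> y(i := \<theta> (x i)) ` {i..<n} \<subseteq> L"
    then have L: "subfield_set L" and \<theta>'_L: "\<And>b. b \<in> A i \<Longrightarrow> d.\<theta>' b \<in> L"
      and y_L: "\<And>j. i \<le> j \<Longrightarrow> j < n \<Longrightarrow> (y(i := \<theta> (x i))) j \<in> L"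
      unfolding \<theta>' by (simp_all add: image_subset_iff del: fun_upd_apply)
    have z: "\<theta> (x i) \<in> L" using y_L[of i] i by simp
    have "\<theta>' (s i) \<in> L" using \<theta>'_L d.B_s unfolding \<theta>' by simp
    then have s_L: "\<theta> (s i) \<in> L" using const[of "s i"] s[OF i] by (simp add: stageD(4)[OF st])
    have "\<theta> b \<in> L" if "b \<in> A i" for b
      by (rule d.\<theta>_mem_subfield[OF L z s_L \<theta>'_L that])
    then have "A (Suc i) \<subseteq> {b \<in> A (Suc i). \<theta> b \<in> L}"
      using z by (intro poly_span_Suc_subset[OF k])
        (auto simp: mono x_mem A_intros stageD(1,2)[OF st] subfield_setD[OF L])
    then have "\<theta> ` A (Suc i) \<subseteq> L" by auto
    moreover have "y ` {Suc i..<n} \<subseteq> L"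
    proof (rule image_subsetI)
      fix j assume "j \<in> {Suc i..<n}"
      then show "y j \<in> L" using y_L[of j] by simp
    qed
    ultimately show "L = UNIV" by (rule stageD(7)[OF st L])
  qed (simp add: const)
qed

text \<open>Multiplying a relation by a power of \<open>\<theta> (x i)\<close> makes its
  coefficients polynomial in \<open>\<theta> (x i)\<close>. Grouping by the part of the monomials
  away from \<open>i\<close> gives a relation of the previous stage, so each group vanishes as a
  polynomial in \<open>x i\<close>. Its leading coefficient, for a term of maximal degree, is a
  coefficient of the original relation.\<close>

lemma independent_stage_step:
  fixes \<theta> :: "'a \<Rightarrow> 'b"
  assumes i: "i < n" and st: "stage (Suc i) \<theta> y" and ind: "independent_stage (Suc i) \<theta> y"
  defines "\<theta>' \<equiv> deleting_derivation.\<theta>' (\<delta> i) \<theta> (\<theta> (x i)) (s i)"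
  shows "independent_stage i \<theta>' (y(i := \<theta> (x i)))"
  unfolding independent_stage_def
proof (intro allI impI, elim conjE, rule ccontr)
  fix S :: "nat multiset set" and b :: "nat multiset \<Rightarrow> 'a"
  let ?z = "\<theta> (x i)"
  let ?y = "y(i := ?z)"
  assume fin: "finite S" and S: "\<forall>M\<in>S. set_mset M \<subseteq> {i..<n} \<and> b M \<in> A i"
    and sum0: "(\<Sum>M\<in>S. \<theta>' (b M) * mono ?y M) = 0" and ex: "\<not> (\<forall>M\<in>S. b M = 0)"
  interpret d: deleting_derivation brF "A i" br "\<alpha> i" "\<delta> i" \<theta> ?z "s i"
    by (rule deleting_derivation_stage[OF i st])
  have \<theta>': "\<theta>' = d.\<theta>'" by (simp add: \<theta>'_def)
  have mono: "b \<in> A (Suc i)" if "b \<in> A i" for b using A_mono[of i "Suc i" b] that by simp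
  note hom = stageD(1,2,4)[OF st]
  have \<theta>_power: "\<theta> (x i ^ e) = ?z ^ e" for e
    by (induction e) (auto simp: hom x_mem A_intros subfield_setD[OF k] poly_span_const)
  have \<theta>_sum: "\<theta> (sum f T) = (\<Sum>j\<in>T. \<theta> (f j))" if "\<And>j. j \<in> T \<Longrightarrow> f j \<in> A (Suc i)" for f :: "'c \<Rightarrow> 'a" and T
    using that by (induction T rule: infinite_finite_induct)
      (auto simp: hom poly_span_sum[OF k] subfield_setD[OF k])
  have z: "?z \<noteq> 0"
  proof
    assume "?z = 0"
    then have "x i = 0"
      using independent_stageD[OF ind, of "{{#}}" "\<lambda>_. x i" "{#}"] by (simp add: x_mem)
    then show False using x_nonzero[OF i] by simp
  qed
  obtain s' where s': "s' \<in> k" "s i * s' = 1" using s[OF i] k unfolding subfield_set_def by blast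
  have "\<exists>c\<in>k. of_nat (fact l) * c = (1::'a)" for l
    using subfield_set_of_nat[OF k, of "fact l"] k unfolding subfield_set_def
    by (metis fact_nonzero of_nat_eq_0_iff)
  then obtain f where f: "\<And>l. f l \<in> k" "\<And>l. of_nat (fact l) * f l = (1::'a)" by metis
  \<comment> \<open>A lift to \<open>k\<close> of the scalar in
    \<open>power_mult_\<theta>'\<close>.\<close>
  define c where "c l = (- s') ^ l * f l" for l
  have c_k: "c l \<in> k" for l
    unfolding c_def using s' f by (intro subfield_setD[OF k] subfield_set_power[OF k]) auto
  have c_0: "c 0 = 1" using f(2)[of 0] by (simp add: c_def)
  have \<theta>_c: "\<theta> (c l) = (- 1 / \<theta> (s i)) ^ l / of_nat (fact l)" for l
  proof -
    have h_pow: "h (a ^ m) = h a ^ m" for a m by (induction m) (auto simp: h_mult)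
    have "h (s i) * h s' = 1" using s'(2) by (metis h_1 h_mult)
    then have "h (- s') = - 1 / \<theta> (s i)"
      using h_nonzero s[OF i] by (simp add: hom h_minus field_simps)
    moreover have "of_nat (fact l) * h (f l) = (1::'b)" using f(2)[of l] by (metis h_1 h_mult h_of_nat)
    then have "h (f l) = 1 / of_nat (fact l)" by (metis d.fact_neq_0 nonzero_mult_div_cancel_left)
    ultimately show ?thesis using c_k[of l] by (simp add: hom c_def h_mult h_pow)
  qed
  \<comment> \<open>A common nilpotency index for the finitely many coefficients.\<close>
  obtain L where L: "\<And>M. M \<in> S \<Longrightarrow> (\<delta> i ^^ L) (b M) = 0"
  proof -
    have "\<exists>N. \<forall>M\<in>S. (\<delta> i ^^ N) (b M) = 0" using fin S
    proof (induction S rule: finite_induct)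
      case (insert M S)
      then obtain N N' where "\<forall>M\<in>S. (\<delta> i ^^ N) (b M) = 0" "(\<delta> i ^^ N') (b M) = 0"
        using d.nilpotent by fastforce
      then have "\<forall>M\<in>insert M S. (\<delta> i ^^ max N N') (b M) = 0"
        by (auto intro: d.pow_eq_0_mono[of N] d.pow_eq_0_mono[of N'])
      then show ?case ..
    qed simp
    then show thesis using that by blast
  qed
  \<comment> \<open>The coefficient of this term will be the leading one after denominators are
    cleared.\<close>
  obtain M0 where M0: "M0 \<in> S" "b M0 \<noteq> 0"
    and max: "\<And>M. M \<in> S \<Longrightarrow> b M \<noteq> 0 \<Longrightarrow> count M i \<le> count M0 i"
  proof -
    let ?T = "(\<lambda>M. count M i) ` {M \<in> S. b M \<noteq> 0}"
    have T: "finite ?T" "?T \<noteq> {}" using fin ex by auto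
    obtain M0 where "M0 \<in> S" "b M0 \<noteq> 0" "count M0 i = Max ?T" using Max_in[OF T] by auto
    then show thesis using that Max_ge[OF T(1)] by auto
  qed
  define rest where "rest M = filter_mset (\<lambda>j. j \<noteq> i) M" for M
  have split: "M = rest M + replicate_mset (count M i) i" for M
    by (rule multiset_eqI) (simp add: rest_def)
  have mono_split: "mono ?y M = mono y (rest M) * ?z ^ count M i" for M
  proof -
    have "mono ?y M = mono ?y (rest M) * ?z ^ count M i"
      by (subst split) simp
    moreover have "mono ?y (rest M) = mono y (rest M)"
      by (rule mono_cong) (simp add: rest_def)
    ultimately show ?thesis by simp
  qed
  define fib where "fib N = {M \<in> S. rest M = N}" for N
  \<comment> \<open>\<open>C N\<close> is a preimage in \<open>A (Suc i)\<close> of the cleared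
    coefficient of the monomial \<open>N\<close> in the later generators.\<close>
  define C where "C N = (\<Sum>M\<in>fib N. \<Sum>l<L. c l * (\<delta> i ^^ l) (b M) * x i ^ (L - l + count M i))" for N
  have fib: "finite (fib N)" "M \<in> fib N \<Longrightarrow> M \<in> S" for N M using fin by (auto simp: fib_def)
  have coef: "c l * (\<delta> i ^^ l) (b M) \<in> A i" if "M \<in> S" for M l
    using that S by (intro A_intros d.B_pow poly_span_const[OF c_k]) auto
  have term_A: "c l * (\<delta> i ^^ l) (b M) * x i ^ e \<in> A (Suc i)" if "M \<in> S" for M l e
    by (rule A_intros(2)[OF mono[OF coef[OF that]]]) (intro A_intros(5) x_mem lessI)
  have C_A: "C N \<in> A (Suc i)" for N
    unfolding C_def using fib(2) by (intro poly_span_sum[OF k] term_A)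
  have \<theta>_C: "\<theta> (C N) * mono y N = ?z ^ L * (\<Sum>M\<in>fib N. \<theta>' (b M) * mono ?y M)" for N
  proof -
    have "\<theta> (C N) = (\<Sum>M\<in>fib N. \<Sum>l<L. \<theta> (c l * (\<delta> i ^^ l) (b M) * x i ^ (L - l + count M i)))"
      unfolding C_def using fib(2)
      by (subst \<theta>_sum, intro poly_span_sum[OF k] term_A, blast, intro sum.cong refl \<theta>_sum term_A)
    also have "\<dots> = (\<Sum>M\<in>fib N. (\<Sum>l<L. (- 1 / \<theta> (s i)) ^ l / of_nat (fact l) * (\<theta> ((\<delta> i ^^ l) (b M)) * ?z ^ (L - l))) * ?z ^ count M i)"
      unfolding sum_distrib_right
    proof (intro sum.cong refl)
      fix M l assume M: "M \<in> fib N"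
      then have "(\<delta> i ^^ l) (b M) \<in> A i" using fib(2) S by (intro d.B_pow) auto
      then show "\<theta> (c l * (\<delta> i ^^ l) (b M) * x i ^ (L - l + count M i)) =
          (- 1 / \<theta> (s i)) ^ l / of_nat (fact l) * (\<theta> ((\<delta> i ^^ l) (b M)) * ?z ^ (L - l)) * ?z ^ count M i"
        unfolding \<theta>_c[symmetric] 
        by (simp add: hom(2) \<theta>_power mono poly_span_const c_k A_intros x_mem power_add mult.assoc)
    qed
    also have "\<dots> = (\<Sum>M\<in>fib N. ?z ^ L * \<theta>' (b M) * ?z ^ count M i)"
      using S L fib(2) z by (intro sum.cong refl) (simp add: \<theta>' d.power_mult_\<theta>')
    finally have "\<theta> (C N) * mono y N = (\<Sum>M\<in>fib N. ?z ^ L * \<theta>' (b M) * ?z ^ count M i * mono y N)"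
      by (simp add: sum_distrib_right)
    also have "\<dots> = (\<Sum>M\<in>fib N. ?z ^ L * (\<theta>' (b M) * mono ?y M))"
      by (intro sum.cong refl) (simp add: mono_split fib_def)
    finally show ?thesis by (simp add: sum_distrib_left)
  qed
  have "(\<Sum>N\<in>rest ` S. \<theta> (C N) * mono y N) = ?z ^ L * (\<Sum>N\<in>rest ` S. \<Sum>M\<in>fib N. \<theta>' (b M) * mono ?y M)"
    by (simp add: \<theta>_C sum_distrib_left)
  also have "(\<Sum>N\<in>rest ` S. \<Sum>M\<in>fib N. \<theta>' (b M) * mono ?y M) = (\<Sum>M\<in>S. \<theta>' (b M) * mono ?y M)"
    unfolding fib_def by (rule sum.image_gen[OF fin, symmetric])
  finally have "(\<Sum>N\<in>rest ` S. \<theta> (C N) * mono y N) = 0" using sum0 by simp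
  moreover have "set_mset (rest M) \<subseteq> {Suc i..<n}" if "M \<in> S" for M
  proof -
    have "set_mset M \<subseteq> {i..<n}" using S that by blast
    then show ?thesis by (auto simp: rest_def dest!: subsetD)
  qed
  ultimately have C0: "C (rest M0) = 0"
    using fin C_A M0(1) by (intro independent_stageD[OF ind, of "rest ` S" C]) auto
  \<comment> \<open>A strict bound for all exponents of \<open>x i\<close> that occur.\<close>
  define E where "E = Suc (L + (\<Sum>M\<in>S. count M i))"
  have E: "L - l + count M i < E" if "M \<in> S" for M l
    using member_le_sum[OF that _ fin, of "\<lambda>M. count M i"] by (simp add: E_def)
  define a where "a e = (\<Sum>M\<in>fib (rest M0). \<Sum>l<L. if L - l + count M i = e then c l * (\<delta> i ^^ l) (b M) else 0)" for e
  have "(\<Sum>e<E. a e * x i ^ e) = (\<Sum>M\<in>fib (rest M0). \<Sum>l<L. \<Sum>e<E. if L - l + count M i = e then c l * (\<delta> i ^^ l) (b M) * x i ^ e else 0)"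
    unfolding a_def sum_distrib_right if_distrib[of "\<lambda>u. u * _"] mult_zero_left
    by (subst sum.swap, rule sum.cong[OF refl], subst sum.swap, rule refl)
  also have "\<dots> = C (rest M0)"
    unfolding C_def
  proof (intro sum.cong refl)
    fix M l assume "M \<in> fib (rest M0)"
    then show "(\<Sum>e<E. if L - l + count M i = e then c l * (\<delta> i ^^ l) (b M) * x i ^ e else 0) =
        c l * (\<delta> i ^^ l) (b M) * x i ^ (L - l + count M i)"
      using E[OF fib(2)] by (simp only: sum.delta' finite_lessThan lessThan_iff if_True)
  qed
  finally have "(\<Sum>e<E. a e * x i ^ e) = 0" using C0 by simp
  moreover have "a e \<in> A i" for e
    unfolding a_def using fib(2) coef by (intro poly_span_sum[OF k]) (simp add: d.B_0)
  ultimately have "a (L + count M0 i) = 0"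
    using E[OF M0(1), of 0] by (intro alg_indep_power_sum_eq_0[OF indep i]) auto
  \<comment> \<open>Among terms with nonzero \<open>b M\<close>, this exponent is reached only at
    \<open>l = 0\<close> and maximal degree, and within one fibre the degree determines the
    monomial.\<close>
  moreover have "a (L + count M0 i) = (\<Sum>M\<in>fib (rest M0). \<Sum>l<L. if l = 0 then (if M = M0 then b M0 else 0) else 0)"
    unfolding a_def
  proof (intro sum.cong refl)
    fix M l assume M: "M \<in> fib (rest M0)" and l: "l \<in> {..<L}"
    show "(if L - l + count M i = L + count M0 i then c l * (\<delta> i ^^ l) (b M) else 0) =
        (if l = 0 then (if M = M0 then b M0 else 0) else 0)"
    proof (cases "b M = 0")
      case True
      then show ?thesis using M0 by auto
    next
      case False
      then have le: "count M i \<le> count M0 i" using max M fib by blast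
      have "M = M0" if "count M i = count M0 i"
        using split[of M] split[of M0] that M by (simp add: fib_def)
      moreover have "L - l + count M i = L + count M0 i \<longleftrightarrow> l = 0 \<and> count M i = count M0 i"
        using le l by auto
      ultimately show ?thesis using c_0 by auto
    qed
  qed
  moreover have "\<dots> = b M0"
  proof -
    \<comment> \<open>This ensures that the index \<open>l = 0\<close> really occurs in the
      sum.\<close>
    have "L > 0" using L[OF M0(1)] M0(2) by (cases L) auto
    moreover have "M0 \<in> fib (rest M0)" using M0 by (simp add: fib_def)
    ultimately show ?thesis using fib(1) by (simp add: sum.delta')
  qed
  ultimately show False using M0(2) by simp
qed

lemma ex_stage: "i \<le> n \<Longrightarrow> \<exists>\<theta> y. stage i \<theta> y \<and> (inj h \<longrightarrow> independent_stage i \<theta> y)"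
proof (induction i rule: inc_induct)
  case base
  show ?case using stage_top independent_stage_top by metis
next
  case (step i)
  then obtain \<theta> y where st: "stage (Suc i) \<theta> y" "inj h \<longrightarrow> independent_stage (Suc i) \<theta> y" by blast
  show ?case
    using stage_step[OF step.hyps(2) st(1)] independent_stage_step[OF step.hyps(2) st(1)] st(2) by metis
qed

end

section \<open>Minimal sets of generators\<close>

text \<open>Quotients of elements of the span form a subfield. Thus generation in terms of
  subfields, the form that the deletion steps preserve, yields the fractions required by
  \<open>poisson_rational_form\<close>.\<close>

lemma generated_fractions:
  fixes y :: "nat \<Rightarrow> 'b::field"
  assumes K: "subfield_set K"
    and gen: "\<And>L. subfield_set L \<Longrightarrow> K \<subseteq> L \<Longrightarrow> y ` {..<m} \<subseteq> L \<Longrightarrow> L = UNIV"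
  shows "\<exists>p\<in>poly_span K y m. \<exists>q\<in>poly_span K y m. q \<noteq> 0 \<and> w = p / q"
proof -
  define R where "R = poly_span K y m"
  note R_intros = poly_span_add[OF K, where y = y and m = m, folded R_def]
    poly_span_mult[OF K, where y = y and m = m, folded R_def]
    poly_span_minus[OF K, where y = y and m = m, folded R_def]
    poly_span_const[of _ K y m, folded R_def]
  define L where "L = {u. \<exists>p\<in>R. \<exists>q\<in>R. q \<noteq> 0 \<and> u = p / q}"
  have L_I: "u \<in> L" if "p \<in> R" "q \<in> R" "q \<noteq> 0" "u = p / q" for u p q
    using that by (auto simp: L_def)
  have R1: "0 \<in> R" "1 \<in> R" by (intro R_intros subfield_setD[OF K])+
  have R_L: "R \<subseteq> L" by (auto intro!: L_I[of _ 1] R1)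
  have "subfield_set L"
    unfolding subfield_set_def
  proof (intro conjI ballI impI)
    show "0 \<in> L" "1 \<in> L" using R1 R_L by auto
    fix a assume "a \<in> L"
    then obtain p q where a: "p \<in> R" "q \<in> R" "q \<noteq> 0" "a = p / q" by (auto simp: L_def)
    show "- a \<in> L" using a by (intro L_I[of "- p" q]) (auto intro: R_intros)
    show "\<exists>b\<in>L. a * b = 1" if "a \<noteq> 0"
      using a that by (intro bexI[of _ "q / p"] L_I[of q p]) auto
    fix b assume "b \<in> L"
    then obtain p' q' where b: "p' \<in> R" "q' \<in> R" "q' \<noteq> 0" "b = p' / q'" by (auto simp: L_def)
    show "a + b \<in> L"
      using a b by (intro L_I[of "p * q' + p' * q" "q * q'"]) (auto intro: R_intros simp: add_frac_eq)
    show "a * b \<in> L"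
      using a b by (intro L_I[of "p * p'" "q * q'"]) (auto intro: R_intros)
  qed
  moreover have "K \<subseteq> L" using R_L by (auto intro: R_intros)
  moreover have "y ` {..<m} \<subseteq> L"
    using R_L poly_span_var[OF K, of _ m y] by (auto simp: R_def)
  ultimately have "L = UNIV" by (rule gen)
  then have "w \<in> L" by simp
  then show ?thesis unfolding L_def R_def by simp
qed

section \<open>Unimodular matrices and integer row operations\<close>

lemma sum_kronecker: "i < n \<Longrightarrow> (\<Sum>l<n. (if i = l then 1 else 0) * f l) = (f i :: 'a::semiring_1)" for i n :: nat
  by (subst sum.cong[OF refl, where h = "\<lambda>l. if i = l then f i else 0"]) auto

lemma GL_int_id: "GL_int n (\<lambda>i j. if i = j then 1 else 0)"
  unfolding GL_int_def
  by (rule exI[of _ "\<lambda>i j. if i = j then 1 else 0"]) (simp add: sum_kronecker)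

lemma GL_int_permute_rows:
  assumes "GL_int n \<sigma>" and \<pi>: "bij_betw \<pi> {..<n} {..<n}"
  shows "GL_int n (\<lambda>i. \<sigma> (\<pi> i))"
proof -
  obtain \<tau> where \<tau>: "\<And>i j. i < n \<Longrightarrow> j < n \<Longrightarrow> (\<Sum>l<n. \<sigma> i l * \<tau> l j) = (if i = j then 1 else 0)"
      "\<And>i j. i < n \<Longrightarrow> j < n \<Longrightarrow> (\<Sum>l<n. \<tau> i l * \<sigma> l j) = (if i = j then 1 else 0)"
    using assms(1) unfolding GL_int_def by blast
  have \<pi>_less: "\<pi> i < n" if "i < n" for i using \<pi> that by (auto simp: bij_betw_def)
  have \<pi>_eq: "\<pi> i = \<pi> j \<longleftrightarrow> i = j" if "i < n" "j < n" for i j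
    using \<pi> that by (auto simp: bij_betw_def inj_on_def)
  have "(\<Sum>l<n. \<tau> i (\<pi> l) * \<sigma> (\<pi> l) j) = (\<Sum>l<n. \<tau> i l * \<sigma> l j)" for i j
    by (rule sum.reindex_bij_betw[OF \<pi>])
  then show ?thesis
    unfolding GL_int_def by (intro exI[of _ "\<lambda>i j. \<tau> i (\<pi> j)"]) (simp add: \<tau> \<pi>_less \<pi>_eq)
qed

lemma GL_int_add_row:
  assumes "GL_int n \<sigma>" and ij: "i < n" "j < n" "i \<noteq> j"
  shows "GL_int n (\<sigma>(j := \<lambda>a. \<sigma> j a + e * \<sigma> i a))" (is "GL_int n ?\<sigma>")
proof -
  obtain \<tau> where \<tau>: "\<And>i j. i < n \<Longrightarrow> j < n \<Longrightarrow> (\<Sum>l<n. \<sigma> i l * \<tau> l j) = (if i = j then 1 else 0)"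
      "\<And>i j. i < n \<Longrightarrow> j < n \<Longrightarrow> (\<Sum>l<n. \<tau> i l * \<sigma> l j) = (if i = j then 1 else 0)"
    using assms(1) unfolding GL_int_def by blast
  \<comment> \<open>Adding \<open>e\<close> times row \<open>i\<close> to row \<open>j\<close> is
    compensated in the inverse by subtracting \<open>e\<close> times column \<open>j\<close> from
    column \<open>i\<close>.\<close>
  define \<tau>' where "\<tau>' a l = (if l = i then \<tau> a i - e * \<tau> a j else \<tau> a l)" for a l
  have left: "(\<Sum>l<n. \<sigma> r l * \<tau>' l c) = (if r = c then 1 else 0) - (if c = i then e * (if r = j then 1 else 0) else 0)"
    if "r < n" "c < n" for r c
    using that \<tau>(1)[of r c] \<tau>(1)[of r j] ij
    by (auto simp: \<tau>'_def right_diff_distrib sum_subtractf mult.left_commute[of _ e] simp flip: sum_distrib_left)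
  have "(\<Sum>l<n. ?\<sigma> r l * \<tau>' l c) = (if r = c then 1 else 0)" if "r < n" "c < n" for r c
    using that ij left[of r c] left[of j c] left[of i c]
    by (auto simp: distrib_right sum.distrib mult.assoc simp flip: sum_distrib_left)
  moreover have "(\<Sum>l<n. \<tau>' a l * ?\<sigma> l b) = (if a = b then 1 else 0)" if "a < n" "b < n" for a b
  proof -
    have "(\<Sum>l<n. \<tau>' a l * ?\<sigma> l b) = (\<Sum>l<n. \<tau> a l * \<sigma> l b + (if l = j then e * \<tau> a j * \<sigma> i b else 0)
        - (if l = i then e * \<tau> a j * \<sigma> i b else 0))"
      using ij by (intro sum.cong) (auto simp: \<tau>'_def algebra_simps)
    also have "\<dots> = (\<Sum>l<n. \<tau> a l * \<sigma> l b)"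
      using ij by (simp add: sum.distrib sum_subtractf)
    finally show ?thesis using \<tau>(2) that by simp
  qed
  ultimately show ?thesis unfolding GL_int_def by blast
qed

text \<open>The bilinear form of \<Lambda> on integer exponent vectors. Taking rows as arguments
  turns row operations on \<sigma> into bilinearity.\<close>

definition integer_form :: "nat \<Rightarrow> (nat \<Rightarrow> nat \<Rightarrow> 'a::comm_ring_1) \<Rightarrow> (nat \<Rightarrow> int) \<Rightarrow> (nat \<Rightarrow> int) \<Rightarrow> 'a" where
  "integer_form n \<Lambda> v w = (\<Sum>a<n. \<Sum>b<n. of_int (v a * w b) * \<Lambda> a b)"

lemma conj_entry_eq_integer_form: "conj_entry n \<sigma> \<Lambda> i j = integer_form n \<Lambda> (\<sigma> i) (\<sigma> j)"
  by (simp add: conj_entry_def integer_form_def)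

lemma integer_form_add_left:
  "integer_form n \<Lambda> (\<lambda>a. v a + e * v' a) w = integer_form n \<Lambda> v w + of_int e * integer_form n \<Lambda> v' w"
  by (simp add: integer_form_def sum.distrib sum_distrib_left algebra_simps)

lemma integer_form_add_right:
  "integer_form n \<Lambda> w (\<lambda>a. v a + e * v' a) = integer_form n \<Lambda> w v + of_int e * integer_form n \<Lambda> w v'"
  by (simp add: integer_form_def sum.distrib sum_distrib_left algebra_simps)

section \<open>Quadratic generators over the Poisson centre\<close>

context poisson_field
begin

lemma of_int_neq_0: "c \<noteq> 0 \<Longrightarrow> of_int c \<noteq> (0::'b)"
  by (cases c rule: int_cases2) (auto simp: of_nat_neq_0)

text \<open>For nonzero \<open>v\<close> and \<open>w\<close>, \<open>c\<close> is the bracket of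
  their logarithms, which is why the rules below are additive.\<close>

definition log_bracket :: "'b \<Rightarrow> 'b \<Rightarrow> 'b \<Rightarrow> bool" where
  "log_bracket v w c \<longleftrightarrow> brF v w = c * v * w"

lemma log_bracket_flip: "log_bracket v w c \<Longrightarrow> log_bracket w v (- c)"
  using skew[of w v] by (simp add: log_bracket_def)

lemma log_bracket_mult_right:
  "log_bracket v w c \<Longrightarrow> log_bracket v w' c' \<Longrightarrow> log_bracket v (w * w') (c + c')"
  by (simp add: log_bracket_def mult_right algebra_simps)

lemma log_bracket_divide_right:
  "log_bracket v w c \<Longrightarrow> log_bracket v w' c' \<Longrightarrow> log_bracket v (w / w') (c - c')"
  by (cases "w' = 0") (simp_all add: log_bracket_def divide_right field_simps)

text \<open>This is the product of \<open>v\<close> and the \<open>e\<close>-th power of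
  \<open>w\<close>, meant for \<open>e\<close> equal to 1 or -1 only.\<close>

definition signed_mult :: "int \<Rightarrow> 'b \<Rightarrow> 'b \<Rightarrow> 'b" where
  "signed_mult e v w = (if e = 1 then v * w else v / w)"

lemma log_bracket_signed_right:
  assumes "e = 1 \<or> e = - 1" "log_bracket v w c" "log_bracket v w' c'"
  shows "log_bracket v (signed_mult e w w') (c + of_int e * c')"
  using assms(1) log_bracket_mult_right[OF assms(2,3)] log_bracket_divide_right[OF assms(2,3)]
  by (auto simp: signed_mult_def)

lemma log_bracket_signed_left:
  assumes "e = 1 \<or> e = - 1" "log_bracket w v c" "log_bracket w' v c'"
  shows "log_bracket (signed_mult e w w') v (c + of_int e * c')"
  using log_bracket_flip[OF log_bracket_signed_right[OF assms(1) log_bracket_flip[OF assms(2)] log_bracket_flip[OF assms(3)]]]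
  by (simp add: add.commute)

definition quadratic_generators ::
  "nat \<Rightarrow> (nat \<Rightarrow> nat \<Rightarrow> 'b) \<Rightarrow> nat \<Rightarrow> (nat \<Rightarrow> nat \<Rightarrow> int) \<Rightarrow> (nat \<Rightarrow> 'b) \<Rightarrow> bool" where
  "quadratic_generators n \<Lambda> p \<sigma> u \<longleftrightarrow> GL_int n \<sigma> \<and> p \<le> n \<and>
    (\<forall>i<p. \<forall>j<p. log_bracket (u i) (u j) (integer_form n \<Lambda> (\<sigma> i) (\<sigma> j))) \<and>
    (\<forall>L. subfield_set L \<longrightarrow> center \<subseteq> L \<longrightarrow> u ` {..<p} \<subseteq> L \<longrightarrow> L = UNIV)"

lemma quadratic_generatorsD:
  assumes "quadratic_generators n \<Lambda> p \<sigma> u"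
  shows "GL_int n \<sigma>" "p \<le> n"
    and "i < p \<Longrightarrow> j < p \<Longrightarrow> log_bracket (u i) (u j) (integer_form n \<Lambda> (\<sigma> i) (\<sigma> j))"
    and "subfield_set L \<Longrightarrow> center \<subseteq> L \<Longrightarrow> u ` {..<p} \<subseteq> L \<Longrightarrow> L = UNIV"
  using assms unfolding quadratic_generators_def by simp_all

text \<open>A central generator lies in every admissible \<open>L\<close>. Its row is exchanged with
  row \<open>p - 1\<close>, which keeps \<sigma> invertible and the surviving rows in front.\<close>

lemma quadratic_generators_drop:
  assumes qg: "quadratic_generators n \<Lambda> p \<sigma> u" and i: "i < p" "u i \<in> center"
  shows "\<exists>\<sigma>' u'. quadratic_generators n \<Lambda> (p - 1) \<sigma>' u'"
proof -
  define \<pi> where "\<pi> l = (if l = i then p - 1 else if l = p - 1 then i else l)" for l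
  note D = quadratic_generatorsD[OF qg]
  have \<pi>\<pi>: "\<pi> (\<pi> l) = l" for l by (auto simp: \<pi>_def)
  have \<pi>_less: "\<pi> l < p" if "l < p" for l using that i by (auto simp: \<pi>_def)
  have "bij_betw \<pi> {..<n} {..<n}"
    using i D(2) by (intro bij_betw_byWitness[where f' = \<pi>]) (auto simp: \<pi>\<pi>, auto simp: \<pi>_def)
  then have "GL_int n (\<lambda>l. \<sigma> (\<pi> l))" by (rule GL_int_permute_rows[OF D(1)])
  moreover have "L = UNIV" if L: "subfield_set L" "center \<subseteq> L" "(\<lambda>l. u (\<pi> l)) ` {..<p - 1} \<subseteq> L" for L
  proof (rule D(4)[OF L(1,2)], rule image_subsetI)
    fix q assume q: "q \<in> {..<p}"
    show "u q \<in> L"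
    proof (cases "q = i")
      case False
      then have "\<pi> q < p - 1" using q i(1) by (auto simp: \<pi>_def)
      then have "u (\<pi> (\<pi> q)) \<in> L" using L(3) by blast
      then show ?thesis by (simp add: \<pi>\<pi>)
    qed (use i L in auto)
  qed
  moreover have "log_bracket (u (\<pi> l)) (u (\<pi> m)) (integer_form n \<Lambda> (\<sigma> (\<pi> l)) (\<sigma> (\<pi> m)))"
    if "l < p - 1" "m < p - 1" for l m
    using D(3)[of "\<pi> l" "\<pi> m"] \<pi>_less that by simp
  ultimately have "quadratic_generators n \<Lambda> (p - 1) (\<lambda>l. \<sigma> (\<pi> l)) (\<lambda>l. u (\<pi> l))"
    unfolding quadratic_generators_def using D(2) by simp
  then show ?thesis by blast
qed

text \<open>Multiplying a generator by another one or its inverse matches the row operation by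
  bilinearity. Since \<open>u i\<close> is nonzero, the old generator can be recovered.\<close>

lemma quadratic_generators_add_row:
  assumes qg: "quadratic_generators n \<Lambda> p \<sigma> u" and ij: "i < p" "j < p" "i \<noteq> j"
    and e: "e = 1 \<or> e = - 1" and nz: "u i \<noteq> 0"
  shows "quadratic_generators n \<Lambda> p (\<sigma>(j := \<lambda>a. \<sigma> j a + e * \<sigma> i a)) (u(j := signed_mult e (u j) (u i)))"
    (is "quadratic_generators n \<Lambda> p ?\<sigma> ?u")
proof -
  note D = quadratic_generatorsD[OF qg]
  \<comment> \<open>The brackets are updated one argument at a time, as both arguments may be the
    changed generator.\<close>
  have left: "log_bracket (?u r) (u c) (integer_form n \<Lambda> (?\<sigma> r) (\<sigma> c))" if "r < p" "c < p" for r c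
    using D(3)[OF that] log_bracket_signed_left[OF e D(3)[OF ij(2) that(2)] D(3)[OF ij(1) that(2)]]
    by (cases "r = j") (simp_all add: integer_form_add_left)
  have right: "log_bracket (?u r) (?u c) (integer_form n \<Lambda> (?\<sigma> r) (?\<sigma> c))" if "r < p" "c < p" for r c
  proof (cases "c = j")
    case True
    then show ?thesis
      using log_bracket_signed_right[OF e left[OF that(1) ij(2)] left[OF that(1) ij(1)]]
      by (simp only: fun_upd_same integer_form_add_right)
  next
    case False
    then show ?thesis using left[OF that] by simp
  qed
  have gen: "L = UNIV" if L: "subfield_set L" "center \<subseteq> L" "?u ` {..<p} \<subseteq> L" for L
  proof (rule D(4)[OF L(1,2)], rule image_subsetI)
    have u_L: "?u q \<in> L" if "q < p" for q by (rule subsetD[OF L(3) imageI]) (use that in simp)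
    fix q assume q: "q \<in> {..<p}"
    show "u q \<in> L"
    proof (cases "q = j")
      case True
      have mem: "signed_mult e (u j) (u i) \<in> L" "u i \<in> L" using u_L[of j] u_L[of i] ij by auto
      have "signed_mult e (u j) (u i) / u i \<in> L" "signed_mult e (u j) (u i) * u i \<in> L"
        using mem L(1) by (auto intro: subfield_set_divide subfield_setD(4))
      then show ?thesis using True nz by (cases "e = 1") (simp_all add: signed_mult_def)
    next
      case False
      then show ?thesis using u_L[of q] q by simp
    qed
  qed
  have "GL_int n ?\<sigma>" using ij D(2) by (intro GL_int_add_row[OF D(1)]) auto
  then show ?thesis
    unfolding quadratic_generators_def by (intro conjI allI impI D(2) right gen)
qed

text \<open>The centralizer of \<open>u i\<close> is a subfield containing the centre and all
  generators.\<close>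

lemma central_if_log_brackets_0:
  assumes qg: "quadratic_generators n \<Lambda> p \<sigma> u" and i: "i < p"
    and zero: "\<And>j. j < p \<Longrightarrow> integer_form n \<Lambda> (\<sigma> j) (\<sigma> i) = 0"
  shows "u i \<in> center"
proof -
  note D = quadratic_generatorsD[OF qg]
  have "brF (u i) (u j) = 0" if "j < p" for j
    using D(3)[OF that i] zero[OF that] by (subst skew) (simp add: log_bracket_def)
  then have "{c. brF (u i) c = 0} = UNIV"
    by (intro D(4)[OF subfield_set_centralizer]) auto
  then have "brF (u i) a = 0" for a by (simp add: set_eq_iff)
  then have "brF a (u i) = 0" for a by (subst skew) simp
  then show ?thesis unfolding center_def by simp
qed

text \<open>A Euclidean algorithm on the coefficients of an integer relation between the rows would produce
  a central generator, which could be dropped.\<close>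
lemma minimal_quadratic_generators_independent:
  assumes minimal: "\<And>p' \<sigma> u. quadratic_generators n \<Lambda> p' \<sigma> u \<Longrightarrow> p \<le> p'"
    and "quadratic_generators n \<Lambda> p \<sigma> u"
    and "\<And>j. j < p \<Longrightarrow> (\<Sum>i<p. of_int (c i) * integer_form n \<Lambda> (\<sigma> j) (\<sigma> i)) = 0"
    and "i < p"
  shows "c i = 0"
  using assms(2-)
proof (induction "nat (\<Sum>i<p. \<bar>c i\<bar>)" arbitrary: c \<sigma> u i rule: less_induct)
  case less
  note qg = less.prems(1) and rel = less.prems(2)
  \<comment> \<open>A central generator could be dropped, against minimality.\<close>
  have not_central: "u l \<notin> center" if "l < p" for l
    using quadratic_generators_drop[OF qg that] minimal[of "p - 1"] that by (metis diff_less le_less_trans less_irrefl zero_less_one not_less_zero neq0_conv)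
  have nz: "u l \<noteq> 0" if "l < p" for l
    using not_central[OF that] subfield_setD(1)[OF subfield_set_center] by auto
  \<comment> \<open>The Euclidean step. Adding \<open>e\<close> times row \<open>l\<close> to row
    \<open>m\<close> and replacing \<open>c l\<close> by \<open>c l - e * c m\<close> preserves the
    relation and lowers the sum of absolute values. The induction hypothesis then forces the
    unchanged coefficient \<open>c m\<close> to be zero.\<close>
  have reduce: False if l: "l < p" "m < p" "l \<noteq> m" "c l \<noteq> 0" "c m \<noteq> 0" "\<bar>c m\<bar> \<le> \<bar>c l\<bar>" for l m
  proof -
    define e where "e = sgn (c l) * sgn (c m)"
    have e: "e = 1 \<or> e = - 1" using l by (auto simp: e_def sgn_if)
    define c' where "c' = c(l := c l - e * c m)"
    define \<sigma>' where "\<sigma>' = \<sigma>(m := \<lambda>a. \<sigma> m a + e * \<sigma> l a)"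
    have qg': "quadratic_generators n \<Lambda> p \<sigma>' (u(m := signed_mult e (u m) (u l)))"
      unfolding \<sigma>'_def using l nz by (intro quadratic_generators_add_row[OF qg _ _ _ e]) auto
    have "\<bar>c' l\<bar> < \<bar>c l\<bar>" using l by (auto simp: c'_def e_def sgn_if abs_if split: if_splits)
    then have "(\<Sum>i<p. \<bar>c' i\<bar>) < (\<Sum>i<p. \<bar>c i\<bar>)"
      using l by (intro sum_strict_mono_ex1) (auto simp: c'_def)
    then have smaller: "nat (\<Sum>i<p. \<bar>c' i\<bar>) < nat (\<Sum>i<p. \<bar>c i\<bar>)"
      by (subst nat_less_eq_zless) (auto intro: sum_nonneg)
    have same: "(\<Sum>i<p. of_int (c' i) * integer_form n \<Lambda> v (\<sigma>' i)) = (\<Sum>i<p. of_int (c i) * integer_form n \<Lambda> v (\<sigma> i))" for v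
    proof -
      let ?d = "of_int (c m * e) * integer_form n \<Lambda> v (\<sigma> l)"
      have "(\<Sum>i<p. of_int (c' i) * integer_form n \<Lambda> v (\<sigma>' i)) =
          (\<Sum>i<p. of_int (c i) * integer_form n \<Lambda> v (\<sigma> i) + (if i = m then ?d else 0) - (if i = l then ?d else 0))"
        using l by (intro sum.cong) (auto simp: c'_def \<sigma>'_def integer_form_add_right algebra_simps)
      also have "\<dots> = (\<Sum>i<p. of_int (c i) * integer_form n \<Lambda> v (\<sigma> i))"
        using l by (simp add: sum.distrib sum_subtractf)
      finally show ?thesis .
    qed
    have rel': "(\<Sum>i<p. of_int (c' i) * integer_form n \<Lambda> (\<sigma>' j) (\<sigma>' i)) = 0" if "j < p" for j
    proof -
      have "(\<Sum>i<p. of_int (c i) * integer_form n \<Lambda> (\<lambda>a. \<sigma> m a + e * \<sigma> l a) (\<sigma> i)) =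
          (\<Sum>i<p. of_int (c i) * integer_form n \<Lambda> (\<sigma> m) (\<sigma> i)) + of_int e * (\<Sum>i<p. of_int (c i) * integer_form n \<Lambda> (\<sigma> l) (\<sigma> i))"
        by (simp add: integer_form_add_left sum.distrib sum_distrib_left algebra_simps)
      then show ?thesis
        unfolding same using rel that l by (auto simp: \<sigma>'_def)
    qed
    have "c' m = 0" by (rule less.hyps[OF smaller qg' rel' l(2)])
    then show False using l by (simp add: c'_def)
  qed
  show "c i = 0"
  proof (rule ccontr)
    assume ci: "c i \<noteq> 0"
    \<comment> \<open>With a single nonzero coefficient left, the relation says that
      \<open>u i\<close> commutes with all generators, hence is central.\<close>
    have others: "c l = 0" if "l < p" "l \<noteq> i" for l
      using reduce[of i l] reduce[of l i] that ci less.prems(3) by (metis linear)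
    have "integer_form n \<Lambda> (\<sigma> j) (\<sigma> i) = 0" if "j < p" for j
    proof -
      have "(\<Sum>l<p. of_int (c l) * integer_form n \<Lambda> (\<sigma> j) (\<sigma> l)) =
          (\<Sum>l<p. if l = i then of_int (c i) * integer_form n \<Lambda> (\<sigma> j) (\<sigma> i) else 0)"
        using others by (intro sum.cong) auto
      then have "of_int (c i) * integer_form n \<Lambda> (\<sigma> j) (\<sigma> i) = 0"
        using rel[OF that] less.prems(3) by simp
      then show ?thesis using of_int_neq_0[OF ci] by simp
    qed
    then show False
      using central_if_log_brackets_0[OF qg less.prems(3)] not_central[OF less.prems(3)] by blast
  qed
qed

text \<open>Distinct monomials are eigenvectors of the derivations \<open>u\<^sub>j\<^sup>-\<^sup>1 {u\<^sub>j, -}\<close> with distinct eigenvalues.\<close>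
lemma alg_indep_if_rows_independent:
  assumes C: "\<And>i j. i < p \<Longrightarrow> j < p \<Longrightarrow> C j i \<in> center"
    and u: "\<And>i j. i < p \<Longrightarrow> j < p \<Longrightarrow> log_bracket (u j) (u i) (C j i)"
    and nz: "\<And>i. i < p \<Longrightarrow> u i \<noteq> 0"
    and rows: "\<And>c i. (\<And>j. j < p \<Longrightarrow> (\<Sum>i<p. of_int (c i) * C j i) = 0) \<Longrightarrow> i < p \<Longrightarrow> c i = 0"
  shows "alg_indep center u p"
  unfolding alg_indep_def
proof (intro allI impI, elim conjE)
  \<comment> \<open>The eigenvalue of the monomial \<open>M\<close> for the derivation attached to
    \<open>u j\<close>.\<close>
  define w where "w j M = (\<Sum>i<p. of_nat (count M i) * C j i)" for j and M :: "nat multiset"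
  note cen = subfield_setD[OF subfield_set_center]
  have w_center: "w j M \<in> center" if "j < p" for j M
    unfolding w_def using that C by (intro subfield_set_sum cen subfield_set_of_nat subfield_set_center) auto
  have bracket_mono: "brF (u j) (mono u M) = u j * (w j M * mono u M)" if "j < p" "set_mset M \<subseteq> {..<p}" for j M
    using that(2)
  proof (induction M)
    case (add i M)
    then have i: "i < p" by simp
    have "w j (add_mset i M) = w j M + (\<Sum>l<p. if l = i then C j i else 0)"
      unfolding w_def sum.distrib[symmetric] by (intro sum.cong) (auto simp: algebra_simps)
    then have "w j (add_mset i M) = w j M + C j i" using i by simp
    then show ?case
      using add u[OF i that(1)] by (simp add: mult_right log_bracket_def algebra_simps)
  qed (simp add: w_def)
  have mono_nz: "mono u M \<noteq> 0" if "set_mset M \<subseteq> {..<p}" for M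
    using that by (induction M) (auto simp: nz)
  have separate: "\<exists>j<p. w j M \<noteq> w j N" if "M \<noteq> N" "set_mset M \<subseteq> {..<p}" "set_mset N \<subseteq> {..<p}" for M N
  proof (rule ccontr)
    assume "\<not> ?thesis"
    \<comment> \<open>Equal weights would give an integer relation between the rows, with
      differences of exponents as coefficients.\<close>
    then have "(\<Sum>i<p. of_int (int (count M i) - int (count N i)) * C j i) = 0" if "j < p" for j
      using that by (simp add: w_def left_diff_distrib sum_subtractf)
    then have "int (count M i) - int (count N i) = 0" if "i < p" for i
      using that by (rule rows[of "\<lambda>i. int (count M i) - int (count N i)" i])
    then have "count M i = count N i" if "i < p" for i using that by simp
    moreover have "count M i = count N i" if "\<not> i < p" for i
    proof -
      have "i \<notin># M" "i \<notin># N" using \<open>set_mset M \<subseteq> {..<p}\<close> \<open>set_mset N \<subseteq> {..<p}\<close> that by auto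
      then show ?thesis by (simp only: not_in_iff)
    qed
    ultimately have "M = N" by (intro multiset_eqI) blast
    then show False using \<open>M \<noteq> N\<close> by simp
  qed
  fix S c
  assume "finite S" "\<forall>M\<in>S. set_mset M \<subseteq> {..<p} \<and> c M \<in> center" "(\<Sum>M\<in>S. c M * mono u M) = 0"
  then show "\<forall>M\<in>S. c M = 0"
  proof (induction S arbitrary: c rule: finite_induct)
    case (insert M0 S)
    have "c M1 = 0" if M1: "M1 \<in> S" for M1
    proof -
      have "M1 \<noteq> M0" using M1 insert.hyps by blast
      then obtain j where j: "j < p" "w j M1 \<noteq> w j M0" using separate[of M1 M0] insert.prems M1 by auto
      \<comment> \<open>Subtracting the \<open>M0\<close> eigenvalue times the relation from its
        bracket with \<open>u j\<close> removes the term of \<open>M0\<close> and leaves a shorter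
        relation.\<close>
      have "0 = brF (u j) (\<Sum>M\<in>insert M0 S. c M * mono u M) - u j * w j M0 * (\<Sum>M\<in>insert M0 S. c M * mono u M)"
        unfolding insert.prems(2) by simp
      also have "brF (u j) (\<Sum>M\<in>insert M0 S. c M * mono u M) = (\<Sum>M\<in>insert M0 S. c M * (u j * (w j M * mono u M)))"
        unfolding sum_right using insert.prems(1) j
        by (intro sum.cong refl) (auto simp: central_mult_right bracket_mono)
      also have "\<dots> - u j * w j M0 * (\<Sum>M\<in>insert M0 S. c M * mono u M) =
          u j * (\<Sum>M\<in>insert M0 S. c M * (w j M - w j M0) * mono u M)"
        by (simp only: sum_distrib_left sum_subtractf[symmetric]) (simp add: algebra_simps)
      also have "\<dots> = u j * (\<Sum>M\<in>S. c M * (w j M - w j M0) * mono u M)"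
        using insert.hyps by simp
      finally have "(\<Sum>M\<in>S. c M * (w j M - w j M0) * mono u M) = 0" using nz[OF j(1)] by simp
      then have "\<forall>M\<in>S. c M * (w j M - w j M0) = 0"
        using insert.prems(1) w_center[OF j(1)] by (intro insert.IH) (auto intro: cen)
      then show ?thesis using M1 j by auto
    qed
    moreover from this have "c M0 = 0"
      using insert.prems insert.hyps mono_nz[of M0] by simp
    ultimately show ?case by blast
  qed simp
qed

text \<open>The given \<open>y\<close> and the identity matrix show that quadratic generators exist.
  Those of least number are algebraically independent over the centre, which serves as
  \<open>K\<close>.\<close>

lemma rational_form_over_center:
  assumes \<Lambda>: "\<And>i j. i < n \<Longrightarrow> j < n \<Longrightarrow> \<Lambda> i j \<in> center"
    and y: "\<And>i j. i < n \<Longrightarrow> j < n \<Longrightarrow> brF (y i) (y j) = \<Lambda> i j * y i * y j"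
    and gen: "\<And>L. subfield_set L \<Longrightarrow> center \<subseteq> L \<Longrightarrow> y ` {..<n} \<subseteq> L \<Longrightarrow> L = UNIV"
    and k': "k' \<subseteq> center"
  shows "\<exists>m \<sigma> K u. m \<le> n \<and> GL_int n \<sigma> \<and> poisson_rational_form brF k' K u m (\<lambda>i j. conj_entry n \<sigma> \<Lambda> i j)"
proof -
  have of_int_if: "of_int (if P then 1 else 0) = (if P then 1 else 0 :: 'b)" for P by simp
  have id: "integer_form n \<Lambda> (\<lambda>l. if i = l then 1 else 0) (\<lambda>l. if j = l then 1 else 0) = \<Lambda> i j"
    if "i < n" "j < n" for i j
    using that by (simp add: integer_form_def mult.assoc of_int_if sum_kronecker flip: sum_distrib_left)
  have "quadratic_generators n \<Lambda> n (\<lambda>i j. if i = j then 1 else 0) y"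
    unfolding quadratic_generators_def
    by (intro conjI allI impI GL_int_id order_refl gen) (simp_all add: log_bracket_def id y)
  then have ex: "\<exists>p \<sigma> u. quadratic_generators n \<Lambda> p \<sigma> u" by blast
  define p where "p = (LEAST p. \<exists>\<sigma> u. quadratic_generators n \<Lambda> p \<sigma> u)"
  obtain \<sigma> u where qg: "quadratic_generators n \<Lambda> p \<sigma> u"
    using LeastI_ex[OF ex] unfolding p_def by blast
  have minimal: "p \<le> p'" if "quadratic_generators n \<Lambda> p' \<sigma>' u'" for p' \<sigma>' u'
    unfolding p_def using that by (intro Least_le) blast
  note D = quadratic_generatorsD[OF qg]
  have form_center: "integer_form n \<Lambda> v w \<in> center" for v w
  proof -
    have "of_int c \<in> center" for c
      by (cases c) (auto intro: subfield_setD[OF subfield_set_center] subfield_set_of_nat[OF subfield_set_center]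
          simp del: of_nat_Suc)
    then show ?thesis
      unfolding integer_form_def using \<Lambda>
      by (intro subfield_set_sum[OF subfield_set_center] subfield_setD(4)[OF subfield_set_center])
        (auto simp del: of_int_mult)
  qed
  have "u l \<noteq> 0" if "l < p" for l
  proof
    assume "u l = 0"
    then have "u l \<in> center" using subfield_setD(1)[OF subfield_set_center] by simp
    then show False
      using quadratic_generators_drop[OF qg that] minimal[of "p - 1"] that by fastforce
  qed
  then have "alg_indep center u p"
    using D(3) form_center
    by (intro alg_indep_if_rows_independent[where C = "\<lambda>j i. integer_form n \<Lambda> (\<sigma> j) (\<sigma> i)"])
      (auto intro: minimal_quadratic_generators_independent[OF minimal qg])
  then have "poisson_rational_form brF k' center u p (\<lambda>i j. conj_entry n \<sigma> \<Lambda> i j)"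
    unfolding poisson_rational_form_def conj_entry_eq_integer_form
    using D(3) k' generated_fractions[OF subfield_set_center D(4)] subfield_set_center
    by (auto simp: log_bracket_def)
  then show ?thesis using D(1,2) by blast
qed

end

section \<open>Rational forms of the quotient field\<close>

context poisson_quotient
begin

lemma h_sum: "h (sum f S) = (\<Sum>i\<in>S. h (f i))"
  by (induction S rule: infinite_finite_induct) (auto simp: h_add)

lemma h_of_int: "h (of_int c) = of_int c"
  by (cases c) (simp_all add: h_of_nat h_minus del: of_nat_Suc)

lemma h_conj_entry: "h (conj_entry n \<sigma> \<Lambda> i j) = conj_entry n \<sigma> (\<lambda>a b. h (\<Lambda> a b)) i j"
  by (simp add: conj_entry_def h_sum h_mult h_of_int)

text \<open>At stage 0 only \<open>A 0\<close>, which is \<open>k\<close>, remains below the new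
  generators, so they generate the field over the image of \<open>k\<close>.\<close>

lemma ex_quadratic_generators:
  obtains y where
    "\<And>i j. i < n \<Longrightarrow> j < n \<Longrightarrow> brF (y i) (y j) = h (antisym_completion lam i j) * y i * y j"
    "\<And>L. subfield_set L \<Longrightarrow> h ` k \<subseteq> L \<Longrightarrow> y ` {..<n} \<subseteq> L \<Longrightarrow> L = UNIV"
    "inj h \<Longrightarrow> alg_indep (h ` k) y n"
proof -
  obtain \<theta> y where st: "stage 0 \<theta> y" and ind: "inj h \<longrightarrow> independent_stage 0 \<theta> y"
    using ex_stage[of 0] by auto
  have A0: "A 0 = k" by (rule poly_span_0[OF k])
  show thesis
  proof
    fix i j assume ij: "i < n" "j < n"
    show "brF (y i) (y j) = h (antisym_completion lam i j) * y i * y j"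
      \<comment> \<open>A stage records only the brackets below the diagonal; skew-symmetry gives
        the others.\<close>
      using stageD(6)[OF st, of j i] stageD(6)[OF st, of i j] skew[of "y i" "y j"] ij
      by (cases i j rule: linorder_cases) (auto simp: antisym_completion_def h_minus)
  next
    fix L assume L: "subfield_set L" "h ` k \<subseteq> L" "y ` {..<n} \<subseteq> L"
    then show "L = UNIV"
      by (intro stageD(7)[OF st]) (auto simp: A0 stageD(4)[OF st] atLeast0LessThan)
  next
    assume inj: "inj h"
    show "alg_indep (h ` k) y n"
      unfolding alg_indep_def
    proof (intro allI impI ballI, elim conjE)
      fix S c M assume S: "finite S" "\<forall>M\<in>S. set_mset M \<subseteq> {..<n} \<and> c M \<in> h ` k" "(\<Sum>M\<in>S. c M * mono y M) = 0"
        and M: "M \<in> S"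
      \<comment> \<open>The coefficients are lifted to \<open>k\<close>, because
        \<open>independent_stage\<close> takes them before \<theta> is applied.\<close>
      define b where "b N = (SOME a. a \<in> k \<and> h a = c N)" for N
      have b: "b N \<in> k" "h (b N) = c N" if "N \<in> S" for N
      proof -
        have "c N \<in> h ` k" using S(2) that by simp
        then have "\<exists>a. a \<in> k \<and> h a = c N" by (elim imageE) auto
        from someI_ex[OF this] show "b N \<in> k" "h (b N) = c N" by (simp_all add: b_def)
      qed
      have "(\<Sum>N\<in>S. \<theta> (b N) * mono y N) = 0"
        using S(3) b by (simp add: stageD(4)[OF st])
      then have "b M = 0"
        using ind inj S b M by (intro independent_stageD[of 0 \<theta> y S b M]) (auto simp: A0 atLeast0LessThan)
      then show "c M = 0" using b(2)[OF M] by simp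
    qed
  qed
qed

lemma rational_form_if_inj:
  assumes "inj h"
  shows "\<exists>y. poisson_rational_form brF (h ` k) (h ` k) y n (\<lambda>i j. h (antisym_completion lam i j))"
proof -
  obtain y where y: "\<And>i j. i < n \<Longrightarrow> j < n \<Longrightarrow> brF (y i) (y j) = h (antisym_completion lam i j) * y i * y j"
    "\<And>L. subfield_set L \<Longrightarrow> h ` k \<subseteq> L \<Longrightarrow> y ` {..<n} \<subseteq> L \<Longrightarrow> L = UNIV"
    "inj h \<Longrightarrow> alg_indep (h ` k) y n"
    by (rule ex_quadratic_generators) blast
  have "poisson_rational_form brF (h ` k) (h ` k) y n (\<lambda>i j. h (antisym_completion lam i j))"
    unfolding poisson_rational_form_def
    using y assms subfield_set_h generated_fractions[OF subfield_set_h y(2)] h_const_center by auto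
  then show ?thesis by (rule exI[where x = y])
qed

lemma ex_rational_form:
  "\<exists>m \<sigma> K u. m \<le> n \<and> GL_int n \<sigma> \<and>
    poisson_rational_form brF (h ` k) K u m (\<lambda>i j. h (conj_entry n \<sigma> (antisym_completion lam) i j))"
proof -
  obtain y where y: "\<And>i j. i < n \<Longrightarrow> j < n \<Longrightarrow> brF (y i) (y j) = h (antisym_completion lam i j) * y i * y j"
    "\<And>L. subfield_set L \<Longrightarrow> h ` k \<subseteq> L \<Longrightarrow> y ` {..<n} \<subseteq> L \<Longrightarrow> L = UNIV"
    by (rule ex_quadratic_generators) blast
  have k_center: "h ` k \<subseteq> center" using h_const_center by auto
  have "antisym_completion lam i j \<in> k" if "i < n" "j < n" for i j
    using that lam by (auto simp: antisym_completion_def intro: subfield_setD[OF k])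
  then show ?thesis
    unfolding h_conj_entry
    using y k_center h_const_center by (intro rational_form_over_center[where y = y]) auto
qed

end

text \<open>The maps \<open>\<alpha> 0\<close> and \<open>\<delta> 0\<close> are unconstrained by the hypotheses. Setting them to zero on
  \<open>A\<^sub>0 = k\<close> makes the first variable behave like the others.\<close>
lemma poisson_quotientI:
  fixes k :: "'a::{comm_ring_1, ring_char_0} set" and brF :: "'b::field \<Rightarrow> 'b \<Rightarrow> 'b"
  assumes A: "iterated_PPA k br x n \<alpha> \<delta>"
    and nilpotent: "\<forall>i. 1 \<le> i \<and> i < n \<longrightarrow> (\<forall>b\<in>poly_span k x i. \<exists>N. (\<delta> i ^^ N) b = 0)"
    and s: "\<forall>i. 1 \<le> i \<and> i < n \<longrightarrow> (\<exists>s\<in>k. s \<noteq> 0 \<and>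
      (\<forall>b\<in>poly_span k x i. \<alpha> i (\<delta> i b) = \<delta> i (\<alpha> i b + s * b)))"
    and lam: "\<forall>i j. j < i \<and> i < n \<longrightarrow> lam i j \<in> k \<and> \<alpha> i (x j) = lam i j * x j"
    and F: "fract_quotient br P brF h"
  obtains s where "poisson_quotient brF k br x n (\<alpha>(0 := \<lambda>_. 0)) (\<delta>(0 := \<lambda>_. 0)) lam s h"
proof -
  have k: "subfield_set k" using A by (simp add: iterated_PPA_def)
  have br: "poisson_bracket br" "k_linear_bracket k br" using A by (simp_all add: iterated_PPA_def)
  have h: "h (a + b) = h a + h b" "h (a * b) = h a * h b" "h 1 = 1"
    "h (br a b) = brF (h a) (h b)" "\<exists>a b. h b \<noteq> 0 \<and> w = h a / h b" "poisson_bracket brF" for a b w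
    using F unfolding fract_quotient_def by blast+
  have h0: "h 0 = 0" by (metis h(1) add_0_right add_cancel_left_right)
  \<comment> \<open>Positive integers are units in \<open>k\<close>, and \<open>h\<close> preserves
    units.\<close>
  have char0: "of_nat m \<noteq> (0::'b)" if "m > 0" for m
  proof -
    have "of_nat m \<in> k" "of_nat m \<noteq> (0::'a)" using subfield_set_of_nat[OF k] that by auto
    then obtain c where "of_nat m * c = (1::'a)" using k unfolding subfield_set_def by blast
    then have "h (of_nat m) * h c = 1" using h(2,3) by metis
    moreover have "h (of_nat m) = of_nat m" by (induction m) (auto simp: h0 h)
    ultimately show ?thesis by auto
  qed
  have br_const: "br c b = 0" if "c \<in> k" for b c
  proof -
    have "br b (1 * 1) = br b 1 * 1 + 1 * br b 1" using br(1) unfolding poisson_bracket_def by blast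
    then have "br b 1 = 0" by simp
    moreover have "br 1 b = - br b 1" using br(1) unfolding poisson_bracket_def by blast
    moreover have "br (c * 1) b = c * br 1 b" using br(2) that unfolding k_linear_bracket_def by blast
    ultimately show ?thesis by simp
  qed
  have "\<exists>s. \<forall>i. 1 \<le> i \<and> i < n \<longrightarrow> s i \<in> k \<and> s i \<noteq> 0 \<and>
      (\<forall>b\<in>poly_span k x i. \<alpha> i (\<delta> i b) = \<delta> i (\<alpha> i b + s i * b))"
    by (rule choice) (use s in blast)
  then obtain s where s: "\<And>i. 1 \<le> i \<Longrightarrow> i < n \<Longrightarrow> s i \<in> k \<and> s i \<noteq> 0 \<and>
      (\<forall>b\<in>poly_span k x i. \<alpha> i (\<delta> i b) = \<delta> i (\<alpha> i b + s i * b))" by blast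
  have zero: "derivation_on k (poly_span k x 0) (\<lambda>_. 0)"
    using k by (simp add: derivation_on_def poly_span_0 subfield_setD)
  have pos: "1 \<le> i" if "i \<noteq> 0" for i :: nat using that by simp
  have PPA: "poisson_derivation_on k br (poly_span k x i) (\<alpha> i)" "derivation_on k (poly_span k x i) (\<delta> i)"
    "skew_poisson_condition br (poly_span k x i) (\<alpha> i) (\<delta> i)"
    "b \<in> poly_span k x i \<Longrightarrow> br (x i) b = \<alpha> i b * x i + \<delta> i b" if "1 \<le> i" "i < n" for i b
    using A that unfolding iterated_PPA_def by blast+
  have br_0: "br a 0 = 0" "br 0 a = 0" for a
    using br_const[OF subfield_setD(1)[OF k], of a] br(1) unfolding poisson_bracket_def by (metis neg_0_equal_iff_equal)+
  \<comment> \<open>The scalar 1 at index 0 is a placeholder: with zero maps the relation holds for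
    every scalar, and the locale asks for a nonzero element of \<open>k\<close>.\<close>
  have "poisson_quotient brF k br x n (\<alpha>(0 := \<lambda>_. 0)) (\<delta>(0 := \<lambda>_. 0)) lam (s(0 := 1)) h"
  proof
    show "poisson_bracket brF" "poisson_bracket br" "k_linear_bracket k br" "subfield_set k"
      using br h k by auto
    show "alg_indep k x n" "poly_span k x n = UNIV" using A by (auto simp: iterated_PPA_def)
    show "of_nat m \<noteq> (0::'b)" if "m > 0" for m using char0 that .
    show "h 1 = 1" by (rule h)
    show "h (a + b) = h a + h b" "h (a * b) = h a * h b" "h (br a b) = brF (h a) (h b)" for a b
      by (rule h)+
    show "\<exists>a b. h b \<noteq> 0 \<and> w = h a / h b" for w by (rule h)
    show "lam i j \<in> k" if "j < i" "i < n" for i j using lam that by blast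
    show "(\<alpha>(0 := \<lambda>_. 0)) i (x j) = lam i j * x j" if "j < i" "i < n" for i j using lam that by simp
    fix i assume i: "i < n"
    show "poisson_derivation_on k br (poly_span k x i) ((\<alpha>(0 := \<lambda>_. 0)) i)"
      using PPA(1)[OF pos i] zero by (cases "i = 0") (auto simp: poisson_derivation_on_def br_0)
    show "derivation_on k (poly_span k x i) ((\<delta>(0 := \<lambda>_. 0)) i)"
      using PPA(2)[OF pos i] zero by (cases "i = 0") auto
    show "skew_poisson_condition br (poly_span k x i) ((\<alpha>(0 := \<lambda>_. 0)) i) ((\<delta>(0 := \<lambda>_. 0)) i)"
      using PPA(3)[OF pos i] by (cases "i = 0") (auto simp: skew_poisson_condition_def br_0)
    show "(s(0 := 1)) i \<in> k" "(s(0 := 1)) i \<noteq> 0"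
      using s[OF pos i] subfield_setD(2)[OF k] by (cases "i = 0"; simp)+
    fix b assume b: "b \<in> poly_span k x i"
    show "br (x i) b = (\<alpha>(0 := \<lambda>_. 0)) i b * x i + (\<delta>(0 := \<lambda>_. 0)) i b"
    proof (cases "i = 0")
      case True
      then have "br b (x i) = 0" using b by (intro br_const) (simp add: poly_span_0[OF k])
      moreover have "br (x i) b = - br b (x i)" using br(1) unfolding poisson_bracket_def by blast
      ultimately show ?thesis using True by simp
    next
      case False
      then show ?thesis using PPA(4)[OF pos i b] by simp
    qed
    show "\<exists>N. ((\<delta>(0 := \<lambda>_. 0)) i ^^ N) b = 0"
    proof (cases "i = 0")
      case True
      then show ?thesis by (intro exI[of _ 1]) simp
    next
      case False
      then show ?thesis using nilpotent pos i b by simp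
    qed
    show "(\<alpha>(0 := \<lambda>_. 0)) i ((\<delta>(0 := \<lambda>_. 0)) i b) =
        (\<delta>(0 := \<lambda>_. 0)) i ((\<alpha>(0 := \<lambda>_. 0)) i b + (s(0 := 1)) i * b)"
      using s[OF pos i] b by (cases "i = 0") auto
  qed
  then show thesis by (rule that)
qed

theorem theorem3p9:
  fixes k :: "'a::{comm_ring_1, ring_char_0} set"
    and br :: "'a \<Rightarrow> 'a \<Rightarrow> 'a"
    and x :: "nat \<Rightarrow> 'a"
    and n :: nat
    and \<alpha> \<delta> :: "nat \<Rightarrow> 'a \<Rightarrow> 'a"
    and lam :: "nat \<Rightarrow> nat \<Rightarrow> 'a"
  assumes A: "iterated_PPA k br x n \<alpha> \<delta>"
    and loc_nilp: "\<forall>i. 1 \<le> i \<and> i < n \<longrightarrow>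
                     (\<forall>b\<in>poly_span k x i. \<exists>N. (\<delta> i ^^ N) b = 0)"
    and s_cond: "\<forall>i. 1 \<le> i \<and> i < n \<longrightarrow> (\<exists>s\<in>k. s \<noteq> 0 \<and>
                     (\<forall>b\<in>poly_span k x i. \<alpha> i (\<delta> i b) = \<delta> i (\<alpha> i b + s * b)))"
    and lam_cond: "\<forall>i j. j < i \<and> i < n \<longrightarrow> lam i j \<in> k \<and> \<alpha> i (x j) = lam i j * x j"
  shows
    "(\<forall>(brF :: 'b::field \<Rightarrow> 'b \<Rightarrow> 'b) h. fract_quotient br {0} brF h \<longrightarrow>
        (\<exists>y. poisson_rational_form brF (h ` k) (h ` k) y n
               (\<lambda>i j. h (antisym_completion lam i j))))
     \<and>
     (\<forall>P. poisson_prime_ideal br P \<longrightarrow>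
        (\<forall>(brF :: 'c::field \<Rightarrow> 'c \<Rightarrow> 'c) h. fract_quotient br P brF h \<longrightarrow>
          (\<exists>m \<sigma> K y. m \<le> n \<and> GL_int n \<sigma> \<and>
             poisson_rational_form brF (h ` k) K y m
               (\<lambda>i j. h (conj_entry n \<sigma> (antisym_completion lam) i j)))))"
proof (intro conjI allI impI)
  fix brF :: "'b \<Rightarrow> 'b \<Rightarrow> 'b" and h
  assume F: "fract_quotient br {0} brF h"
  obtain s where "poisson_quotient brF k br x n (\<alpha>(0 := \<lambda>_. 0)) (\<delta>(0 := \<lambda>_. 0)) lam s h"
    by (rule poisson_quotientI[OF A loc_nilp s_cond lam_cond F])
  then interpret poisson_quotient brF k br x n "\<alpha>(0 := \<lambda>_. 0)" "\<delta>(0 := \<lambda>_. 0)" lam s h .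
  \<comment> \<open>The kernel of \<open>h\<close> is the zero ideal here; injectivity provides the
    algebraic independence.\<close>
  have "inj h"
  proof (rule injI)
    fix a b assume "h a = h b"
    then have "h (a - b) = 0" using h_add[of "a - b" b] by simp
    then have "a - b \<in> {0}" using F unfolding fract_quotient_def by blast
    then show "a = b" by simp
  qed
  then show "\<exists>y. poisson_rational_form brF (h ` k) (h ` k) y n (\<lambda>i j. h (antisym_completion lam i j))"
    by (rule rational_form_if_inj)
next
  fix P and brF :: "'c \<Rightarrow> 'c \<Rightarrow> 'c" and h
  assume F: "fract_quotient br P brF h"
  obtain s where "poisson_quotient brF k br x n (\<alpha>(0 := \<lambda>_. 0)) (\<delta>(0 := \<lambda>_. 0)) lam s h"
    by (rule poisson_quotientI[OF A loc_nilp s_cond lam_cond F])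
  then interpret poisson_quotient brF k br x n "\<alpha>(0 := \<lambda>_. 0)" "\<delta>(0 := \<lambda>_. 0)" lam s h .
  show "\<exists>m \<sigma> K y. m \<le> n \<and> GL_int n \<sigma> \<and> poisson_rational_form brF (h ` k) K y m
      (\<lambda>i j. h (conj_entry n \<sigma> (antisym_completion lam) i j))"
    by (rule ex_rational_form)
qed

end
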